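(* For any CR dimension $n$: let $\Sigma$ be a $p$-minimal hypersurface in $H_n$ which is defined by the graph $t=f$ of a function $f$ defined on the whole space $\mathbb R^{2n}$. If, moreover, $\Sigma$ is umbilic, then it is a horizontal hyperplane $\{t=\mathrm{const}\}$ after a Heisenberg rigid motion.
   Context: The Heisenberg group $H_n$ (of CR dimension $n$) is $\mathbb R^{2n+1}$ with coordinates $(x_1,\dots,x_n,y_1,\dots,y_n,t)$, $z=(x_1+iy_1,\dots,x_n+iy_n)$, group law $(x,y,t)\circ(x',y',t')=(x+x',y+y',t+t'+\sum_j(y_jx_j'-x_jy_j'))$, contact form $\Theta=dt+\sum_{j}(x_jdy_j-y_jdx_j)$, contact bundle $\xi=\ker\Theta$, and left-invariant fields $\mathring e_\beta=\partial_{x_\beta}+y_\beta\partial_t$, $\mathring e_{n+\beta}=\partial_{y_\beta}-x_\beta\partial_t$, $T=\partial_t$. $J\mathring e_\beta=\mathring e_{n+\beta}$, $J\mathring e_{n+\beta}=-\mathring e_\beta$; the Levi metric $G$ on $\xi$ makes $\mathring e_1,\dots,\mathring e_{2n}$ orthonormal; $\nabla$ is the pseudohermitian connection, for which all $\mathring e_a$ and $T$ are parallel. Heisenberg rigid motions are the elements of $PSH(n)$, generated by left translations and the maps $(z,t)\mapsto(Az,t)$, $A\in U(n)$. Hypersurfaces are $C^2$, and $C^\infty$ in the region of regular points. A point $p\in\Sigma$ is singular if $\xi=T\Sigma$ at $p$, otherwise regular. At regular points let $\xi'=(\xi\cap T\Sigma)\cap J(\xi\cap T\Sigma)$, let $e_n\in\xi\cap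 T\Sigma$ be a unit vector $G$-orthogonal to $\xi'$, and $e_{2n}=Je_n$. Define $\alpha$ by $\alpha e_{2n}+T\in T\Sigma$ and $J'$ on $\xi\cap T\Sigma$ by $J'=J$ on $\xi'$, $J'e_n=0$. The shape operator is $\mathfrak S(v)=-\nabla_ve_{2n}+\alpha J'v$, a symmetric operator on $\xi\cap T\Sigma$. A regular point is umbilic if $\mathfrak S(\xi')\subset\xi'$ and all eigenvalues of $\mathfrak S$ acting on $\xi'$ are the same; this common eigenvalue is denoted $k$. Moreover $\mathfrak S(e_n)=le_n$ for some real $l$, and at an umbilic point the $p$-mean curvature is $H=l+(2n-2)k$. $\Sigma$ is umbilic if all its regular points are umbilic; it is $p$-minimal if $H=0$ at all regular points.
   Formalization: Umbilic is taken to require that the common eigenvalue k on ξ' exists, so CR dimension n = 1 (where ξ' = 0) is excluded; with the vacuous reading the claim fails there, since t = xy in H_1 is an entire p-minimal graph that is not a plane. *)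

theory Defs
  imports "HOL-Analysis.Analysis"
begin

subsection \<open>Functions of class C^k\<close>

text \<open>Meant for open \<open>S\<close>. Clause \<open>Suc k\<close> says that \<open>f\<close> is differentiable and that all its
  first-order partial derivatives are of class \<open>C^k\<close>.\<close>

primrec C_k_on :: "nat \<Rightarrow> ('a::euclidean_space \<Rightarrow> real) \<Rightarrow> 'a set \<Rightarrow> bool" where
  "C_k_on 0 f S \<longleftrightarrow> continuous_on S f"
| "C_k_on (Suc k) f S \<longleftrightarrow>
     (\<forall>x\<in>S. f differentiable (at x)) \<and>
     (\<forall>b\<in>Basis. C_k_on k (\<lambda>x. frechet_derivative f (at x) b) S)"

definition smooth_on :: "('a::euclidean_space \<Rightarrow> real) \<Rightarrow> 'a set \<Rightarrow> bool" where
  "smooth_on f S \<longleftrightarrow> (\<forall>k. C_k_on k f S)"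


subsection \<open>The Heisenberg group\<close>

text \<open>A point is \<open>(z, t)\<close> with \<open>z $ j = x_j + \<i> y_j\<close>; the CR dimension is \<open>CARD('n)\<close>.
  The real inner product of \<open>complex ^ 'n\<close> is the Euclidean one of \<open>R^{2n}\<close>. Tangent vectors are
  given by their coordinates in \<open>\<partial>/\<partial>x_j\<close>, \<open>\<partial>/\<partial>y_j\<close>, \<open>\<partial>/\<partial>t\<close> and hence also have type \<open>'n heis\<close>.\<close>

type_synonym 'n heis = "(complex ^ 'n) \<times> real"

definition heis_mult :: "'n::finite heis \<Rightarrow> 'n heis \<Rightarrow> 'n heis" where
  "heis_mult p q =
     (fst p + fst q,
      snd p + snd q + (\<Sum>j\<in>UNIV. Im (fst p $ j) * Re (fst q $ j) - Re (fst p $ j) * Im (fst q $ j)))"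

definition contact_form :: "'n::finite heis \<Rightarrow> 'n heis \<Rightarrow> real" where
  "contact_form p v =
     snd v + (\<Sum>j\<in>UNIV. Re (fst p $ j) * Im (fst v $ j) - Im (fst p $ j) * Re (fst v $ j))"

definition contact_plane :: "'n::finite heis \<Rightarrow> 'n heis set" where
  "contact_plane p = {v. contact_form p v = 0}"

text \<open>\<open>frame_x j\<close> and \<open>frame_y j\<close> are the left-invariant fields written \<open>e_j\<close> and \<open>e_{n+j}\<close>
  on paper.\<close>

definition frame_x :: "'n \<Rightarrow> 'n::finite heis \<Rightarrow> 'n heis" where
  "frame_x j p = (axis j 1, Im (fst p $ j))"

definition frame_y :: "'n \<Rightarrow> 'n::finite heis \<Rightarrow> 'n heis" where
  "frame_y j p = (axis j \<i>, - Re (fst p $ j))"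

definition T_field :: "'n::finite heis" where
  "T_field = (0, 1)"

text \<open>The horizontal vector at \<open>p\<close> with frame coefficients \<open>Re (w $ j)\<close>, \<open>Im (w $ j)\<close>. For a
  horizontal vector \<open>v\<close> the coefficient vector is just \<open>fst v\<close>
  (\<open>horizontal_lift_fst\<close> below).\<close>

definition horizontal_lift :: "'n::finite heis \<Rightarrow> complex ^ 'n \<Rightarrow> 'n heis" where
  "horizontal_lift p w =
     (\<Sum>j\<in>UNIV. Re (w $ j) *\<^sub>R frame_x j p + Im (w $ j) *\<^sub>R frame_y j p)"

text \<open>\<open>J\<close> and the Levi metric are meaningful on horizontal vectors only. In terms of the frame
  coefficients they are multiplication by \<open>\<i>\<close> and the Euclidean inner product.\<close>

definition J_map :: "'n::finite heis \<Rightarrow> 'n heis \<Rightarrow> 'n heis" where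
  "J_map p v = horizontal_lift p (\<i> *s fst v)"

definition levi_metric :: "'n::finite heis \<Rightarrow> 'n heis \<Rightarrow> real" where
  "levi_metric v w = fst v \<bullet> fst w"

lemma fst_horizontal_lift [simp]: "fst (horizontal_lift p w) = w"
proof (rule vec_eq_iff[THEN iffD2], rule allI)
  fix i
  have "fst (horizontal_lift p w) $ i =
      (\<Sum>j\<in>UNIV. (Re (w $ j) *\<^sub>R axis j 1 + Im (w $ j) *\<^sub>R axis j \<i>) $ i)"
    by (simp add: horizontal_lift_def frame_x_def frame_y_def fst_sum)
  also have "\<dots> = (\<Sum>j\<in>UNIV. if j = i then w $ i else 0)"
    by (rule sum.cong) (auto simp: axis_def complex_eq_iff)
  finally show "fst (horizontal_lift p w) $ i = w $ i" by simp
qed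

lemma snd_horizontal_lift:
  "snd (horizontal_lift p w) =
     (\<Sum>j\<in>UNIV. Im (fst p $ j) * Re (w $ j) - Re (fst p $ j) * Im (w $ j))"
  by (simp add: horizontal_lift_def frame_x_def frame_y_def snd_sum algebra_simps)

lemma horizontal_lift_in_contact_plane: "horizontal_lift p w \<in> contact_plane p"
  by (simp add: contact_plane_def contact_form_def snd_horizontal_lift flip: sum.distrib)

lemma horizontal_lift_fst:
  assumes "v \<in> contact_plane p"
  shows "horizontal_lift p (fst v) = v"
proof (rule prod_eqI)
  show "snd (horizontal_lift p (fst v)) = snd v"
    using assms
    by (simp add: contact_plane_def contact_form_def snd_horizontal_lift sum_subtractf)
qed simp

lemma horizontal_lift_axis:
  "horizontal_lift p (axis j 1) = frame_x j p"
  "horizontal_lift p (axis j \<i>) = frame_y j p"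
  by (auto intro!: prod_eqI simp: snd_horizontal_lift)
     (auto simp: frame_x_def frame_y_def axis_def if_distrib if_distribR sum_subtractf sum_negf
           cong: if_cong)

lemma J_map_frame:
  "J_map p (frame_x j p) = frame_y j p"
  "J_map p (frame_y j p) = - frame_x j p"
proof -
  have "\<i> *s axis j 1 = axis j \<i>"
    by (auto simp: vec_eq_iff axis_def)
  then show "J_map p (frame_x j p) = frame_y j p"
    by (simp add: J_map_def frame_x_def horizontal_lift_axis)
  have "\<i> *s axis j \<i> = - axis j 1"
    by (auto simp: vec_eq_iff axis_def)
  moreover have "horizontal_lift p (- w) = - horizontal_lift p w" for w
    by (simp add: horizontal_lift_def flip: sum_negf)
  ultimately show "J_map p (frame_y j p) = - frame_x j p"
    by (simp add: J_map_def horizontal_lift_axis frame_y_def[of j p])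
qed

lemma levi_metric_frame:
  "levi_metric (frame_x i p) (frame_x j p) = (if i = j then 1 else 0)"
  "levi_metric (frame_y i p) (frame_y j p) = (if i = j then 1 else 0)"
  "levi_metric (frame_x i p) (frame_y j p) = 0"
  by (auto simp: levi_metric_def frame_x_def frame_y_def inner_axis_axis inner_complex_def)


subsection \<open>Heisenberg rigid motions\<close>

definition unitary_matrix :: "complex ^ 'n ^ 'n::finite \<Rightarrow> bool" where
  "unitary_matrix A \<longleftrightarrow> (\<chi> i j. cnj (A $ j $ i)) ** A = mat 1"

inductive_set PSH :: "('n::finite heis \<Rightarrow> 'n heis) set" where
  translation: "heis_mult q \<in> PSH"
| unitary: "unitary_matrix A \<Longrightarrow> (\<lambda>(z, t). (A *v z, t)) \<in> PSH"
| compose: "\<phi> \<in> PSH \<Longrightarrow> \<psi> \<in> PSH \<Longrightarrow> \<phi> \<circ> \<psi> \<in> PSH"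
| inverse: "\<phi> \<in> PSH \<Longrightarrow> inv \<phi> \<in> PSH"


subsection \<open>Geometry of hypersurfaces\<close>

definition tangent_space :: "'n::finite heis set \<Rightarrow> 'n heis \<Rightarrow> 'n heis set" where
  "tangent_space \<Sigma> p =
     {v. \<exists>\<gamma> \<epsilon>. \<epsilon> > 0 \<and> (\<forall>s\<in>{-\<epsilon><..<\<epsilon>}. \<gamma> s \<in> \<Sigma>) \<and> \<gamma> 0 = p \<and>
              (\<gamma> has_vector_derivative v) (at (0::real))}"

definition singular_point :: "'n::finite heis set \<Rightarrow> 'n heis \<Rightarrow> bool" where
  "singular_point \<Sigma> p \<longleftrightarrow> p \<in> \<Sigma> \<and> contact_plane p = tangent_space \<Sigma> p"

definition regular_point :: "'n::finite heis set \<Rightarrow> 'n heis \<Rightarrow> bool" where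
  "regular_point \<Sigma> p \<longleftrightarrow> p \<in> \<Sigma> \<and> \<not> singular_point \<Sigma> p"

definition horizontal_tangent :: "'n::finite heis set \<Rightarrow> 'n heis \<Rightarrow> 'n heis set" where
  "horizontal_tangent \<Sigma> p = contact_plane p \<inter> tangent_space \<Sigma> p"

text \<open>The bundle written \<open>\<xi>'\<close> on paper.\<close>

definition xi' :: "'n::finite heis set \<Rightarrow> 'n heis \<Rightarrow> 'n heis set" where
  "xi' \<Sigma> p = horizontal_tangent \<Sigma> p \<inter> J_map p ` horizontal_tangent \<Sigma> p"

text \<open>A choice \<open>e\<close> of the unit field \<open>e_n\<close> on \<open>\<Sigma> \<inter> U\<close>. At each point \<open>e_n\<close> is determined up to
  sign; differentiability makes the choice of sign locally constant. Replacing \<open>e\<close> by \<open>- e\<close>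
  changes the sign of \<open>e_{2n}\<close>, \<open>\<alpha>\<close>, the shape operator and the p-mean curvature, so that
  umbilicity and the vanishing of the p-mean curvature do not depend on the choice.\<close>

definition characteristic_field ::
    "'n::finite heis set \<Rightarrow> 'n heis set \<Rightarrow> ('n heis \<Rightarrow> 'n heis) \<Rightarrow> bool" where
  "characteristic_field \<Sigma> U e \<longleftrightarrow>
     open U \<and>
     (\<forall>q\<in>\<Sigma> \<inter> U.
        regular_point \<Sigma> q \<and>
        e q \<in> horizontal_tangent \<Sigma> q \<and>
        levi_metric (e q) (e q) = 1 \<and>
        (\<forall>v\<in>xi' \<Sigma> q. levi_metric (e q) v = 0) \<and>
        (\<lambda>q. fst (e q)) differentiable (at q within \<Sigma>))"

definition e_2n :: "('n::finite heis \<Rightarrow> 'n heis) \<Rightarrow> 'n heis \<Rightarrow> 'n heis" where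
  "e_2n e p = J_map p (e p)"

definition alpha :: "'n::finite heis set \<Rightarrow> ('n heis \<Rightarrow> 'n heis) \<Rightarrow> 'n heis \<Rightarrow> real" where
  "alpha \<Sigma> e p = (THE a. a *\<^sub>R e_2n e p + T_field \<in> tangent_space \<Sigma> p)"

text \<open>\<open>v - levi_metric v (e p) *\<^sub>R e p\<close> is the component of \<open>v\<close> in \<open>\<xi>'\<close>, so this is the linear map
  equal to \<open>J\<close> on \<open>\<xi>'\<close> and to zero on \<open>e_n\<close>.\<close>

definition J'_map :: "('n::finite heis \<Rightarrow> 'n heis) \<Rightarrow> 'n heis \<Rightarrow> 'n heis \<Rightarrow> 'n heis" where
  "J'_map e p v = J_map p (v - levi_metric v (e p) *\<^sub>R e p)"

text \<open>The pseudohermitian covariant derivative, at \<open>p\<close> in the direction \<open>v\<close> tangent to \<open>\<Sigma>\<close>, of a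
  horizontal field \<open>Y\<close> along \<open>\<Sigma>\<close>. As the frame is parallel, the frame coefficients \<open>fst (Y q)\<close> are
  differentiated. The derivative within \<open>\<Sigma>\<close> is uniquely determined on tangent vectors only.\<close>

definition nabla ::
    "'n::finite heis set \<Rightarrow> 'n heis \<Rightarrow> 'n heis \<Rightarrow> ('n heis \<Rightarrow> 'n heis) \<Rightarrow> 'n heis" where
  "nabla \<Sigma> p v Y = horizontal_lift p (frechet_derivative (\<lambda>q. fst (Y q)) (at p within \<Sigma>) v)"

definition shape_operator ::
    "'n::finite heis set \<Rightarrow> ('n heis \<Rightarrow> 'n heis) \<Rightarrow> 'n heis \<Rightarrow> 'n heis \<Rightarrow> 'n heis" where
  "shape_operator \<Sigma> e p v = - nabla \<Sigma> p v (e_2n e) + alpha \<Sigma> e p *\<^sub>R J'_map e p v"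

definition xi'_eigenvalues ::
    "'n::finite heis set \<Rightarrow> ('n heis \<Rightarrow> 'n heis) \<Rightarrow> 'n heis \<Rightarrow> real set" where
  "xi'_eigenvalues \<Sigma> e p =
     {k. \<exists>v\<in>xi' \<Sigma> p. v \<noteq> 0 \<and> shape_operator \<Sigma> e p v = k *\<^sub>R v}"

text \<open>There is exactly one eigenvalue, the number \<open>k\<close>. In CR dimension 1 one has \<open>\<xi>' = 0\<close>, there is
  no \<open>k\<close>, and no regular point counts as umbilic.\<close>

definition umbilic_point ::
    "'n::finite heis set \<Rightarrow> ('n heis \<Rightarrow> 'n heis) \<Rightarrow> 'n heis \<Rightarrow> bool" where
  "umbilic_point \<Sigma> e p \<longleftrightarrow>
     shape_operator \<Sigma> e p ` xi' \<Sigma> p \<subseteq> xi' \<Sigma> p \<and> (\<exists>k. xi'_eigenvalues \<Sigma> e p = {k})"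

definition levi_orthonormal_basis :: "'n::finite heis set \<Rightarrow> 'n heis set \<Rightarrow> bool" where
  "levi_orthonormal_basis V B \<longleftrightarrow>
     finite B \<and> span B = V \<and> (\<forall>v\<in>B. \<forall>w\<in>B. levi_metric v w = (if v = w then 1 else 0))"

text \<open>The p-mean curvature is the trace of the shape operator on \<open>\<xi> \<inter> T\<Sigma>\<close>, computed in some
  orthonormal basis. At an umbilic point it is \<open>l + (2n-2) k\<close>, since \<open>\<xi> \<inter> T\<Sigma>\<close> is spanned by
  \<open>e_n\<close> and the \<open>(2n-2)\<close>-dimensional space \<open>\<xi>'\<close>.\<close>

definition p_mean_curvature ::
    "'n::finite heis set \<Rightarrow> ('n heis \<Rightarrow> 'n heis) \<Rightarrow> 'n heis \<Rightarrow> real" where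
  "p_mean_curvature \<Sigma> e p =
     (\<Sum>v\<in>(SOME B. levi_orthonormal_basis (horizontal_tangent \<Sigma> p) B).
        levi_metric (shape_operator \<Sigma> e p v) v)"

definition umbilic :: "'n::finite heis set \<Rightarrow> bool" where
  "umbilic \<Sigma> \<longleftrightarrow>
     (\<forall>p. regular_point \<Sigma> p \<longrightarrow>
        (\<exists>U e. p \<in> U \<and> characteristic_field \<Sigma> U e \<and> umbilic_point \<Sigma> e p))"

definition p_minimal :: "'n::finite heis set \<Rightarrow> bool" where
  "p_minimal \<Sigma> \<longleftrightarrow>
     (\<forall>p. regular_point \<Sigma> p \<longrightarrow>
        (\<exists>U e. p \<in> U \<and> characteristic_field \<Sigma> U e \<and> p_mean_curvature \<Sigma> e p = 0))"

definition heis_graph :: "(complex ^ 'n::finite \<Rightarrow> real) \<Rightarrow> 'n heis set" where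
  "heis_graph f = {(z, t). t = f z}"

text \<open>The graph of \<open>f\<close> is a hypersurface of class \<open>C^2\<close>, and smooth in the region of its regular
  points.\<close>

definition graph_hypersurface :: "(complex ^ 'n::finite \<Rightarrow> real) \<Rightarrow> bool" where
  "graph_hypersurface f \<longleftrightarrow>
     C_k_on 2 f UNIV \<and> smooth_on f {z. regular_point (heis_graph f) (z, f z)}"

end

theory Submission
  imports Defs
begin

text \<open>
  Let \<open>F = grad f + \<i> z\<close> and let \<open>A\<close> be the Hessian of \<open>f\<close>. A horizontal vector with frame
  coefficients \<open>w\<close> is tangent to the graph iff \<open>w\<close> is orthogonal to \<open>F\<close>, so the singular points are
  the zeros of \<open>F\<close>, and \<open>e_{2n} = \<plusminus>F/|F|\<close>, \<open>\<alpha> = \<plusminus>1/|F|\<close>. As \<open>D F = A + \<i>\<close>, the derivative of the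
  normal contributes a skew term, which is exactly what \<open>\<alpha> J'\<close> removes: up to the factor
  \<open>\<minusplus>1/|F|\<close>, the shape operator is the compression of \<open>A\<close> to the orthogonal complement of \<open>F\<close>
  (\<open>shape_operator_graph\<close>). A symmetric operator with a single eigenvalue is a scalar, so with
  \<open>m = 2n - 1\<close> and \<open>E = \<i> F\<close> the two curvature conditions say that this compression is
  \<open>\<kappa> (1 - m E \<otimes> E / |F|\<^sup>2)\<close> for one unknown function \<open>\<kappa>\<close> (\<open>umbilic_minimal_hessian\<close>).

  The third derivative of \<open>f\<close> is totally symmetric. Differentiating the form just found and
  exchanging arguments determines the rest of \<open>A\<close> and the whole differential of \<open>\<kappa>\<close>: with
  \<open>V = (\<i> - \<kappa>) F\<close>,
    \<open>A u = \<kappa> u - (m \<kappa> / |F|\<^sup>2) \<langle>V, u\<rangle> V\<close> and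
    \<open>d\<kappa>(u) = (m \<kappa> (1 + \<kappa>\<^sup>2) / |F|\<^sup>2) \<langle>V, u\<rangle>\<close>
  (\<open>structure_equations\<close>). It follows from these equations that \<open>z - F/(\<kappa> + \<i>)\<close> is locally constant
  on the regular set (\<open>P_derivative\<close>). Let \<open>p\<close> be one of its values. Where it is attained one has
  \<open>F = (\<kappa> + \<i>)(z - p)\<close>, hence \<open>|F| \<ge> |z - p|\<close>, and the region where this holds has no boundary
  point except possibly \<open>p\<close>. Since the complement of \<open>p\<close> is connected, it is the regular set, and
  \<open>F = (\<kappa> + \<i>)(z - p)\<close> on all of it (\<open>regular_set_punctured\<close>).

  Here the graph being entire enters a second time: \<open>|z - p|\<^sup>2\<^sup>m \<kappa>\<^sup>2 / (1 + \<kappa>\<^sup>2)\<close> is constant by the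
  equation for \<open>\<kappa>\<close>, and it tends to 0 at \<open>p\<close>. So \<open>\<kappa> = 0\<close>, \<open>grad f = - \<i> p\<close>, and \<open>f\<close> is affine
  (\<open>graph_is_affine\<close>). The left translation that takes \<open>(p, 0)\<close> to the origin makes the graph of
  such an \<open>f\<close> horizontal.
\<close>

section \<open>Gradient, Hessian and third derivative\<close>

text \<open>The proof is the classical one: for small \<open>s\<close> the second difference
  \<open>f (z + s u + s v) - f (z + s u) - f (z + s v) + f z\<close>, which is symmetric in \<open>u\<close> and \<open>v\<close>, equals
  \<open>s\<^sup>2 (A u \<bullet> v) + o(s\<^sup>2)\<close> by the mean value theorem in the direction \<open>v\<close>.\<close>

lemma symmetric_derivative_of_gradient:
  fixes f :: "'a::real_inner \<Rightarrow> real"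
  assumes "open U" "z \<in> U"
    and f: "\<And>x. x \<in> U \<Longrightarrow> (f has_derivative (\<lambda>h. G x \<bullet> h)) (at x)"
    and G: "(G has_derivative A) (at z)"
  shows "A u \<bullet> v = A v \<bullet> u"
proof -
  define \<Delta> where "\<Delta> s = f (z + s *\<^sub>R u + s *\<^sub>R v) - f (z + s *\<^sub>R u) - f (z + s *\<^sub>R v) + f z" for s
  interpret A: bounded_linear A
    using G by (rule has_derivative_bounded_linear)
  have approx: "\<exists>d>0. \<forall>s. 0 < s \<and> s < d \<longrightarrow>
      \<bar>f (z + s *\<^sub>R p + s *\<^sub>R q) - f (z + s *\<^sub>R p) - f (z + s *\<^sub>R q) + f z - s\<^sup>2 * (A p \<bullet> q)\<bar> \<le> e * s\<^sup>2"
    if "e > 0" for p q :: 'a and e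
  proof -
    define M where "M = (norm p + norm q + 1) * (norm q + 1)"
    have "M > 0"
      unfolding M_def by (intro mult_pos_pos add_nonneg_pos) auto
    define c where "c = e / (2 * M)"
    have "c > 0" using \<open>M > 0\<close> that by (simp add: c_def)
    obtain d1 where d1: "d1 > 0" "ball z d1 \<subseteq> U"
      using assms(1,2) openE by blast
    obtain d2 where d2: "d2 > 0"
      and G2: "\<And>y. norm (y - z) < d2 \<Longrightarrow> norm (G y - G z - A (y - z)) \<le> c * norm (y - z)"
      using G \<open>c > 0\<close> unfolding has_derivative_at_alt by blast
    define d where "d = min d1 d2 / (norm p + norm q + 1)"
    have K: "norm p + norm q + 1 > 0" by (smt (verit) norm_ge_zero)
    have "d > 0" using d1 d2 K by (simp add: d_def)
    moreover have "\<bar>f (z + s *\<^sub>R p + s *\<^sub>R q) - f (z + s *\<^sub>R p) - f (z + s *\<^sub>R q) + f z - s\<^sup>2 * (A p \<bullet> q)\<bar>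
        \<le> e * s\<^sup>2" if s: "0 < s" "s < d" for s
    proof -
      have sK: "s * (norm p + norm q + 1) < min d1 d2"
        using s K by (simp add: d_def pos_less_divide_eq)
      have near: "norm (a *\<^sub>R p + t *\<^sub>R q) \<le> s * (norm p + norm q + 1)"
        if "0 \<le> a" "a \<le> s" "0 \<le> t" "t \<le> s" for a t
      proof -
        have "norm (a *\<^sub>R p + t *\<^sub>R q) \<le> a * norm p + t * norm q"
          using norm_triangle_ineq[of "a *\<^sub>R p" "t *\<^sub>R q"] that by simp
        also have "\<dots> \<le> s * norm p + s * norm q"
          using that by (intro add_mono mult_right_mono) auto
        also have "\<dots> \<le> s * (norm p + norm q + 1)"
          using s by (simp add: algebra_simps)
        finally show ?thesis .
      qed
      have inU: "z + a *\<^sub>R p + t *\<^sub>R q \<in> U" if "0 \<le> a" "a \<le> s" "0 \<le> t" "t \<le> s" for a t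
        using near[OF that] sK d1(2) by (auto simp: subset_iff dist_norm norm_minus_commute add.assoc)
      define g where "g t = f (z + s *\<^sub>R p + t *\<^sub>R q) - f (z + t *\<^sub>R q)" for t
      have gd: "(g has_real_derivative (G (z + s *\<^sub>R p + t *\<^sub>R q) - G (z + t *\<^sub>R q)) \<bullet> q) (at t)"
        if "0 \<le> t" "t \<le> s" for t
      proof -
        have 1: "((\<lambda>t. f (z + s *\<^sub>R p + t *\<^sub>R q)) has_derivative (\<lambda>h. G (z + s *\<^sub>R p + t *\<^sub>R q) \<bullet> (h *\<^sub>R q))) (at t)"
          using inU[of s t] that s
          by (intro has_derivative_compose[OF _ f, of "\<lambda>t. z + s *\<^sub>R p + t *\<^sub>R q", simplified])
             (auto intro!: derivative_eq_intros)
        have 2: "((\<lambda>t. f (z + t *\<^sub>R q)) has_derivative (\<lambda>h. G (z + t *\<^sub>R q) \<bullet> (h *\<^sub>R q))) (at t)"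
          using inU[of 0 t] that s
          by (intro has_derivative_compose[OF _ f, of "\<lambda>t. z + t *\<^sub>R q", simplified])
             (auto intro!: derivative_eq_intros)
        show ?thesis
          unfolding has_field_derivative_def g_def
          by (rule has_derivative_eq_rhs[OF has_derivative_diff[OF 1 2]])
             (auto simp: fun_eq_iff inner_diff_left algebra_simps)
      qed
      obtain \<xi> where \<xi>: "0 < \<xi>" "\<xi> < s"
        and g: "g s - g 0 = (s - 0) * ((G (z + s *\<^sub>R p + \<xi> *\<^sub>R q) - G (z + \<xi> *\<^sub>R q)) \<bullet> q)"
        using MVT2[of 0 s g "\<lambda>t. (G (z + s *\<^sub>R p + t *\<^sub>R q) - G (z + t *\<^sub>R q)) \<bullet> q"] s gd by blast
      define x where "x = s *\<^sub>R p + \<xi> *\<^sub>R q"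
      define y where "y = \<xi> *\<^sub>R q"
      have nx: "norm x \<le> s * (norm p + norm q + 1)" and ny: "norm y \<le> s * (norm p + norm q + 1)"
        using near[of s \<xi>] near[of 0 \<xi>] s \<xi> by (auto simp: x_def y_def)
      have "norm (G (z + x) - G z - A x) \<le> c * norm x"
        using G2[of "z + x"] nx sK by auto
      then have ex: "norm (G (z + x) - G z - A x) \<le> c * (s * (norm p + norm q + 1))"
        using nx \<open>c > 0\<close> by (meson mult_left_mono less_imp_le order_trans)
      have "norm (G (z + y) - G z - A y) \<le> c * norm y"
        using G2[of "z + y"] ny sK by auto
      then have ey: "norm (G (z + y) - G z - A y) \<le> c * (s * (norm p + norm q + 1))"
        using ny \<open>c > 0\<close> by (meson mult_left_mono less_imp_le order_trans)
      have "A x - A y = s *\<^sub>R A p"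
        by (simp add: x_def y_def A.add A.scaleR)
      then have "G (z + x) - G (z + y) - s *\<^sub>R A p = (G (z + x) - G z - A x) - (G (z + y) - G z - A y)"
        by (simp add: algebra_simps)
      then have "norm (G (z + x) - G (z + y) - s *\<^sub>R A p)
          \<le> norm (G (z + x) - G z - A x) + norm (G (z + y) - G z - A y)"
        by (simp only: norm_triangle_ineq4)
      also have "\<dots> \<le> 2 * c * s * (norm p + norm q + 1)"
        using ex ey by simp
      finally have dn: "norm (G (z + x) - G (z + y) - s *\<^sub>R A p) \<le> 2 * c * s * (norm p + norm q + 1)" .
      have "f (z + s *\<^sub>R p + s *\<^sub>R q) - f (z + s *\<^sub>R p) - f (z + s *\<^sub>R q) + f z - s\<^sup>2 * (A p \<bullet> q)
          = g s - g 0 - s\<^sup>2 * (A p \<bullet> q)"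
        by (simp add: g_def)
      also have "\<dots> = s * ((G (z + x) - G (z + y) - s *\<^sub>R A p) \<bullet> q)"
        by (simp add: g x_def y_def inner_diff_left power2_eq_square algebra_simps)
      finally have "\<bar>f (z + s *\<^sub>R p + s *\<^sub>R q) - f (z + s *\<^sub>R p) - f (z + s *\<^sub>R q) + f z - s\<^sup>2 * (A p \<bullet> q)\<bar>
          = s * \<bar>(G (z + x) - G (z + y) - s *\<^sub>R A p) \<bullet> q\<bar>"
        using s by (simp add: abs_mult)
      also have "\<dots> \<le> s * ((2 * c * s * (norm p + norm q + 1)) * (norm q + 1))"
      proof (intro mult_left_mono)
        have "\<bar>(G (z + x) - G (z + y) - s *\<^sub>R A p) \<bullet> q\<bar>
            \<le> norm (G (z + x) - G (z + y) - s *\<^sub>R A p) * norm q"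
          by (rule Cauchy_Schwarz_ineq2)
        also have "\<dots> \<le> (2 * c * s * (norm p + norm q + 1)) * (norm q + 1)"
          using dn order_trans[OF norm_ge_zero dn] by (intro mult_mono) auto
        finally show "\<bar>(G (z + x) - G (z + y) - s *\<^sub>R A p) \<bullet> q\<bar> \<le> \<dots>" .
      qed (use s in auto)
      also have "\<dots> = (2 * c * M) * s\<^sup>2"
        by (simp add: M_def power2_eq_square algebra_simps)
      also have "2 * c * M = e"
        using \<open>M > 0\<close> by (simp add: c_def)
      finally show ?thesis .
    qed
    ultimately show ?thesis by blast
  qed
  show ?thesis
  proof (rule ccontr)
    assume ne: "A u \<bullet> v \<noteq> A v \<bullet> u"
    define e where "e = \<bar>A u \<bullet> v - A v \<bullet> u\<bar> / 3"
    have "e > 0" using ne by (simp add: e_def)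
    obtain d1 where "d1 > 0" and d1: "\<And>s. 0 < s \<Longrightarrow> s < d1 \<Longrightarrow>
      \<bar>f (z + s *\<^sub>R u + s *\<^sub>R v) - f (z + s *\<^sub>R u) - f (z + s *\<^sub>R v) + f z - s\<^sup>2 * (A u \<bullet> v)\<bar> \<le> e * s\<^sup>2"
      using approx[OF \<open>e > 0\<close>, of u v] by blast
    obtain d2 where "d2 > 0" and d2: "\<And>s. 0 < s \<Longrightarrow> s < d2 \<Longrightarrow>
      \<bar>f (z + s *\<^sub>R v + s *\<^sub>R u) - f (z + s *\<^sub>R v) - f (z + s *\<^sub>R u) + f z - s\<^sup>2 * (A v \<bullet> u)\<bar> \<le> e * s\<^sup>2"
      using approx[OF \<open>e > 0\<close>, of v u] by blast
    define s where "s = min d1 d2 / 2"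
    have s: "0 < s" "s < d1" "s < d2"
      using \<open>d1 > 0\<close> \<open>d2 > 0\<close> by (auto simp: s_def)
    have sw: "z + s *\<^sub>R v + s *\<^sub>R u = z + s *\<^sub>R u + s *\<^sub>R v" by simp
    have "\<bar>s\<^sup>2 * (A u \<bullet> v) - s\<^sup>2 * (A v \<bullet> u)\<bar> \<le> 2 * (e * s\<^sup>2)"
      using d1[OF s(1,2)] d2[OF s(1,3)] unfolding sw by linarith
    then have "s\<^sup>2 * \<bar>A u \<bullet> v - A v \<bullet> u\<bar> \<le> s\<^sup>2 * (2 * e)"
      unfolding right_diff_distrib[symmetric] abs_mult by (simp add: mult_ac)
    then have "3 * e \<le> 2 * e"
      using s by (simp add: e_def)
    then show False using \<open>e > 0\<close> by simp
  qed
qed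

definition gradient :: "('a::euclidean_space \<Rightarrow> real) \<Rightarrow> 'a \<Rightarrow> 'a" where
  "gradient f z = (\<Sum>b\<in>Basis. frechet_derivative f (at z) b *\<^sub>R b)"

definition hessian :: "('a::euclidean_space \<Rightarrow> real) \<Rightarrow> 'a \<Rightarrow> 'a \<Rightarrow> 'a" where
  "hessian f z = frechet_derivative (gradient f) (at z)"

lemma has_derivative_gradient:
  assumes "f differentiable (at z)"
  shows "(f has_derivative (\<lambda>h. gradient f z \<bullet> h)) (at z)"
proof -
  have d: "(f has_derivative frechet_derivative f (at z)) (at z)"
    using assms frechet_derivative_works by blast
  interpret D: bounded_linear "frechet_derivative f (at z)"
    using d by (rule has_derivative_bounded_linear)
  have "frechet_derivative f (at z) h = gradient f z \<bullet> h" for h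
  proof -
    have "frechet_derivative f (at z) h = frechet_derivative f (at z) (\<Sum>b\<in>Basis. (h \<bullet> b) *\<^sub>R b)"
      by (simp add: euclidean_representation)
    also have "\<dots> = gradient f z \<bullet> h"
      by (simp add: gradient_def D.sum D.scaleR inner_sum_left mult.commute inner_commute[of h])
    finally show ?thesis .
  qed
  then have "frechet_derivative f (at z) = (\<lambda>h. gradient f z \<bullet> h)"
    by (rule ext)
  then show ?thesis using d by simp
qed

lemma C_k_on_2_differentiable:
  assumes "C_k_on 2 f S" "z \<in> S"
  shows "f differentiable (at z)" "gradient f differentiable (at z)"
proof -
  show "f differentiable (at z)"
    using assms by (simp add: numeral_2_eq_2)
  have "(\<lambda>x. frechet_derivative f (at x) b) differentiable (at z)" if "b \<in> Basis" for b
    using assms that by (simp add: numeral_2_eq_2)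
  then have "(\<lambda>x. \<Sum>b\<in>Basis. frechet_derivative f (at x) b *\<^sub>R b) differentiable (at z)"
    by (intro differentiable_sum differentiable_scaleR) auto
  then show "gradient f differentiable (at z)"
    by (simp add: gradient_def[abs_def])
qed

lemma C_k_on_Suc_imp: "C_k_on (Suc k) f S \<Longrightarrow> C_k_on k f S"
proof (induction k arbitrary: f)
  case 0
  then show ?case
    by (auto intro!: continuous_at_imp_continuous_on differentiable_imp_continuous_within)
qed auto

lemma has_derivative_hessian:
  assumes "C_k_on 2 f S" "z \<in> S"
  shows "(gradient f has_derivative hessian f z) (at z)"
  using C_k_on_2_differentiable(2)[OF assms] by (simp add: hessian_def frechet_derivative_works)

lemma hessian_symmetric:
  assumes "C_k_on 2 f S" "open S" "z \<in> S"
  shows "hessian f z u \<bullet> v = hessian f z v \<bullet> u"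
  using assms has_derivative_gradient C_k_on_2_differentiable(1) has_derivative_hessian
  by (intro symmetric_derivative_of_gradient[of S z f "gradient f"]) blast+

lemma hessian_differentiable:
  assumes "C_k_on 3 f S" "open S" "z \<in> S"
  shows "(\<lambda>x. hessian f x w) differentiable (at z)"
proof -
  have C: "C_k_on (Suc (Suc (Suc 0))) f S"
    using assms(1) by (simp add: numeral_3_eq_3)
  have C2: "C_k_on 2 f S"
    using C C_k_on_Suc_imp by (simp only: numeral_2_eq_2)
  have comp: "frechet_derivative (\<lambda>y. frechet_derivative f (at y) b) (at x) c = hessian f x c \<bullet> b"
    if "x \<in> S" "b \<in> Basis" for x b c
  proof -
    have "((\<lambda>y. gradient f y \<bullet> b) has_derivative (\<lambda>h. hessian f x h \<bullet> b)) (at x)"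
      using has_derivative_hessian[OF C2] that by (blast intro: has_derivative_inner_left)
    moreover have "(\<lambda>y. gradient f y \<bullet> b) = (\<lambda>y. frechet_derivative f (at y) b)"
      using that by (simp add: gradient_def inner_sum_left inner_Basis if_distrib cong: if_cong)
    ultimately show ?thesis
      using frechet_derivative_at[of "\<lambda>y. gradient f y \<bullet> b" "\<lambda>h. hessian f x h \<bullet> b" x] by metis
  qed
  have "(\<lambda>x. hessian f x c) differentiable (at z)" if "c \<in> Basis" for c
  proof -
    have "(\<lambda>x. \<Sum>b\<in>Basis. frechet_derivative (\<lambda>y. frechet_derivative f (at y) b) (at x) c *\<^sub>R b)
        differentiable (at z)"
      using C assms(3) that by (intro differentiable_sum differentiable_scaleR) auto
    then obtain D where D: "((\<lambda>x. \<Sum>b\<in>Basis. frechet_derivative (\<lambda>y. frechet_derivative f (at y) b) (at x) c *\<^sub>R b)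
        has_derivative D) (at z)"
      by (auto simp: differentiable_def)
    have "((\<lambda>x. hessian f x c) has_derivative D) (at z)"
      using D assms(2,3)
      by (rule has_derivative_transform_within_open) (simp add: comp euclidean_representation)
    then show ?thesis by (auto simp: differentiable_def)
  qed
  then have "(\<lambda>x. \<Sum>c\<in>Basis. (w \<bullet> c) *\<^sub>R hessian f x c) differentiable (at z)"
    by (intro differentiable_sum differentiable_scaleR) auto
  then obtain D where D: "((\<lambda>x. \<Sum>c\<in>Basis. (w \<bullet> c) *\<^sub>R hessian f x c) has_derivative D) (at z)"
    by (auto simp: differentiable_def)
  have lin: "bounded_linear (hessian f x)" if "x \<in> S" for x
    using has_derivative_hessian[OF C2] that has_derivative_bounded_linear by blast
  have "((\<lambda>x. hessian f x w) has_derivative D) (at z)"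
    using D assms(2,3)
  proof (rule has_derivative_transform_within_open)
    fix x assume "x \<in> S"
    then interpret bounded_linear "hessian f x" by (rule lin)
    show "(\<Sum>c\<in>Basis. (w \<bullet> c) *\<^sub>R hessian f x c) = hessian f x w"
      using euclidean_representation[of w] by (metis (mono_tags, lifting) scaleR sum sum.cong)
  qed
  then show ?thesis by (auto simp: differentiable_def)
qed

definition third_derivative :: "('a::euclidean_space \<Rightarrow> real) \<Rightarrow> 'a \<Rightarrow> 'a \<Rightarrow> 'a \<Rightarrow> 'a \<Rightarrow> real" where
  "third_derivative f z u v w = frechet_derivative (\<lambda>x. hessian f x v) (at z) u \<bullet> w"

lemma has_derivative_third_derivative:
  assumes "C_k_on 3 f S" "open S" "z \<in> S"
  shows "((\<lambda>x. hessian f x v \<bullet> w) has_derivative (\<lambda>u. third_derivative f z u v w)) (at z)"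
  unfolding third_derivative_def
  by (rule has_derivative_inner_left) (use hessian_differentiable[OF assms] frechet_derivative_works in blast)

text \<open>The second symmetry is \<open>symmetric_derivative_of_gradient\<close> for the function
  \<open>\<lambda>x. gradient f x \<bullet> w\<close>: by the symmetry of the Hessian its gradient is \<open>\<lambda>x. hessian f x w\<close>.\<close>

lemma third_derivative_symmetric:
  assumes "C_k_on 3 f S" "open S" "z \<in> S"
  shows "third_derivative f z u v w = third_derivative f z u w v"
    and "third_derivative f z u v w = third_derivative f z v u w"
proof -
  have C2: "C_k_on 2 f S"
    using assms(1) C_k_on_Suc_imp by (simp only: numeral_2_eq_2 numeral_3_eq_3)
  have "((\<lambda>x. hessian f x v \<bullet> w) has_derivative (\<lambda>u. third_derivative f z u w v)) (at z)" for v w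
    using has_derivative_third_derivative[OF assms, of w v] assms(2,3)
    by (rule has_derivative_transform_within_open) (rule hessian_symmetric[OF C2 assms(2)])
  then have "(\<lambda>u. third_derivative f z u v w) = (\<lambda>u. third_derivative f z u w v)" for v w
    using has_derivative_third_derivative[OF assms] has_derivative_unique by blast
  then show 2: "third_derivative f z u v w = third_derivative f z u w v" for u v w
    by (rule fun_cong)
  have grad: "((\<lambda>x. gradient f x \<bullet> w) has_derivative (\<lambda>h. hessian f x w \<bullet> h)) (at x)" if "x \<in> S" for x
    using has_derivative_inner_left[OF has_derivative_hessian[OF C2 that], of w]
      hessian_symmetric[OF C2 assms(2) that] by simp
  have "((\<lambda>x. hessian f x w) has_derivative frechet_derivative (\<lambda>x. hessian f x w) (at z)) (at z)"
    using hessian_differentiable[OF assms] frechet_derivative_works by blast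
  from symmetric_derivative_of_gradient[OF assms(2,3) grad this, of u v]
  show "third_derivative f z u v w = third_derivative f z v u w"
    unfolding 2[of u v w] 2[of v u w] unfolding third_derivative_def .
qed

section \<open>Symmetric operators with a single eigenvalue\<close>

text \<open>A maximum point \<open>v\<close> of the quadratic form on the unit sphere of \<open>W\<close> is an eigenvector: the form
  \<open>M |w|\<^sup>2 - B w \<bullet> w\<close> is nonnegative on \<open>W\<close> and vanishes at \<open>v\<close>, and its first variation in the
  direction \<open>u = M v - B v\<close> is \<open>2 |u|\<^sup>2\<close>, so \<open>u = 0\<close>.\<close>

lemma symmetric_operator_top_eigenvalue:
  fixes B :: "'a::euclidean_space \<Rightarrow> 'a"
  assumes W: "subspace W" and B: "linear B" "B ` W \<subseteq> W"
    and sym: "\<And>u w. u \<in> W \<Longrightarrow> w \<in> W \<Longrightarrow> B u \<bullet> w = B w \<bullet> u"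
    and x: "x \<in> W" "x \<noteq> 0"
  obtains M v where "v \<in> W" "v \<noteq> 0" "B v = M *\<^sub>R v" "\<And>w. w \<in> W \<Longrightarrow> B w \<bullet> w \<le> M * (w \<bullet> w)"
proof -
  have "compact (W \<inter> sphere 0 1)"
    by (simp add: closed_Int_compact closed_subspace[OF W])
  moreover have "(1 / norm x) *\<^sub>R x \<in> W \<inter> sphere 0 1"
    using x W by (simp add: subspace_scale)
  moreover have "continuous_on (W \<inter> sphere 0 1) (\<lambda>w. B w \<bullet> w)"
    by (intro continuous_intros linear_continuous_on[OF linear_conv_bounded_linear[THEN iffD1]] B)
  ultimately have "\<exists>v\<in>W \<inter> sphere 0 1. \<forall>w\<in>W \<inter> sphere 0 1. B w \<bullet> w \<le> B v \<bullet> v"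
    by (intro continuous_attains_sup) auto
  then obtain v where v: "v \<in> W" "norm v = 1"
    and max: "\<And>w. w \<in> W \<Longrightarrow> norm w = 1 \<Longrightarrow> B w \<bullet> w \<le> B v \<bullet> v"
    by auto
  define M where "M = B v \<bullet> v"
  have le: "B w \<bullet> w \<le> M * (w \<bullet> w)" if "w \<in> W" for w
  proof (cases "w = 0")
    case True
    then show ?thesis using linear_0[OF B(1)] by simp
  next
    case False
    have "B ((1 / norm w) *\<^sub>R w) \<bullet> ((1 / norm w) *\<^sub>R w) \<le> M"
      unfolding M_def using False that W by (intro max) (simp_all add: subspace_scale)
    then have "B w \<bullet> w / (norm w)\<^sup>2 \<le> M"
      by (simp add: linear_cmul[OF B(1)] power2_eq_square divide_inverse mult_ac)
    then show ?thesis
      using False by (simp add: pos_divide_le_eq power2_norm_eq_inner)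
  qed
  define u where "u = M *\<^sub>R v - B v"
  have u: "u \<in> W"
    unfolding u_def using W B(2) v by (intro subspace_diff subspace_scale) auto
  define a where "a = u \<bullet> u"
  define c where "c = M * a - B u \<bullet> u"
  have quad: "0 \<le> 2 * t * a + t\<^sup>2 * c" for t
  proof -
    have "v + t *\<^sub>R u \<in> W"
      using W u v by (intro subspace_add subspace_scale)
    from le[OF this] have "0 \<le> M * ((v + t *\<^sub>R u) \<bullet> (v + t *\<^sub>R u)) - B (v + t *\<^sub>R u) \<bullet> (v + t *\<^sub>R u)"
      by simp
    also have "\<dots> = (M * (v \<bullet> v) - B v \<bullet> v) + t * (2 * M * (v \<bullet> u) - B v \<bullet> u - B u \<bullet> v) + t\<^sup>2 * c"
      by (simp add: linear_add[OF B(1)] linear_cmul[OF B(1)] c_def a_def inner_add_left inner_add_right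
          power2_eq_square inner_commute[of u v] algebra_simps)
    also have "M * (v \<bullet> v) - B v \<bullet> v = 0"
      using v(2) by (simp add: M_def norm_eq_1)
    also have "2 * M * (v \<bullet> u) - B v \<bullet> u - B u \<bullet> v = 2 * a"
      using sym[OF v(1) u] by (simp add: a_def u_def inner_diff_left)
    finally show ?thesis by (simp add: mult_ac)
  qed
  have "a = 0"
  proof (rule ccontr)
    assume "a \<noteq> 0"
    then have "a > 0" by (simp add: a_def)
    \<comment> \<open>At \<open>t = - a / C\<close> the negative linear term \<open>2 t a\<close> outweighs \<open>t\<^sup>2 c\<close>, as \<open>c < 2 C\<close>.\<close>
    define C where "C = \<bar>c\<bar> + 1"
    have "C > 0" by (simp add: C_def)
    have "0 \<le> C\<^sup>2 * (2 * (- (a / C)) * a + (- (a / C))\<^sup>2 * c)"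
      using quad[of "- (a / C)"] by simp
    also have "\<dots> = a\<^sup>2 * (c - 2 * C)"
      using \<open>C > 0\<close> by (simp add: field_simps power2_eq_square)
    also have "\<dots> < 0"
      using \<open>a > 0\<close> by (simp add: C_def mult_pos_neg)
    finally show False by simp
  qed
  then have "B v = M *\<^sub>R v"
    by (simp add: a_def u_def)
  then show ?thesis
    using that[of v M] v le by force
qed

text \<open>The largest and the smallest eigenvalue coincide, so the quadratic form of \<open>k - B\<close> vanishes on
  \<open>W\<close>, and polarization gives \<open>B = k\<close> there.\<close>

lemma symmetric_operator_single_eigenvalue:
  fixes B :: "'a::euclidean_space \<Rightarrow> 'a"
  assumes W: "subspace W" and B: "linear B" "B ` W \<subseteq> W"
    and sym: "\<And>u w. u \<in> W \<Longrightarrow> w \<in> W \<Longrightarrow> B u \<bullet> w = B w \<bullet> u"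
    and eig: "{l. \<exists>v\<in>W. v \<noteq> 0 \<and> B v = l *\<^sub>R v} = {k}" and w: "w \<in> W"
  shows "B w = k *\<^sub>R w"
proof -
  obtain x where x: "x \<in> W" "x \<noteq> 0" using eig by blast
  obtain M v where "v \<in> W" "v \<noteq> 0" "B v = M *\<^sub>R v" and le: "\<And>w. w \<in> W \<Longrightarrow> B w \<bullet> w \<le> M * (w \<bullet> w)"
    using symmetric_operator_top_eigenvalue[OF W B sym x] by blast
  then have M: "M = k" using eig by blast
  have lin: "linear (\<lambda>w. - B w)" using B(1) by (simp add: linear_compose_neg)
  have im: "(\<lambda>w. - B w) ` W \<subseteq> W" using B(2) W by (auto intro: subspace_neg)
  obtain M' v' where v': "v' \<in> W" "v' \<noteq> 0" "- B v' = M' *\<^sub>R v'"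
    and ge: "\<And>w. w \<in> W \<Longrightarrow> - B w \<bullet> w \<le> M' * (w \<bullet> w)"
    using symmetric_operator_top_eigenvalue[OF W lin im _ x] sym by (metis inner_minus_left)
  have "B v' = (- M') *\<^sub>R v'" using v'(3) by (metis minus_minus scaleR_minus_left)
  then have "- M' = k" using eig v' by blast
  then have M': "M' = - k" by simp
  define K where "K w = k *\<^sub>R w - B w" for w
  have K: "linear K" unfolding K_def
    by (intro linear_compose_sub linear_scale_self B)
  have KW: "K w \<in> W" if "w \<in> W" for w
    unfolding K_def using that W B(2) by (intro subspace_diff subspace_scale) auto
  have zero: "K w \<bullet> w = 0" if "w \<in> W" for w
    using le[OF that] ge[OF that] M M' by (simp add: K_def inner_diff_left)
  have "K (w + K w) \<bullet> (w + K w) = 0"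
    using zero KW w W by (simp add: subspace_add)
  then have "K w \<bullet> K w + K (K w) \<bullet> w = 0"
    using zero[OF w] zero[OF KW[OF w]] by (simp add: linear_add[OF K] inner_add_left inner_add_right)
  moreover have "K u \<bullet> v = K v \<bullet> u" if "u \<in> W" "v \<in> W" for u v
    using sym[OF that] by (simp add: K_def inner_diff_left inner_commute[of u v])
  then have "K (K w) \<bullet> w = K w \<bullet> K w"
    using KW w by blast
  ultimately have "K w = 0" by simp
  then show ?thesis by (simp add: K_def)
qed

lemma orthonormal_sum_inner_squares:
  fixes B :: "'a::euclidean_space set"
  assumes "finite B" and on: "\<And>v w. v \<in> B \<Longrightarrow> w \<in> B \<Longrightarrow> v \<bullet> w = (if v = w then 1 else 0)"
    and x: "x \<in> span B"
  shows "(\<Sum>v\<in>B. (v \<bullet> x)\<^sup>2) = x \<bullet> x"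
proof -
  obtain a where a: "x = (\<Sum>v\<in>B. a v *\<^sub>R v)"
    using x span_finite[OF assms(1)] by auto
  have ax: "v \<bullet> x = a v" if "v \<in> B" for v
  proof -
    have "v \<bullet> x = (\<Sum>w\<in>B. if v = w then a v else 0)"
      unfolding a inner_sum_right by (rule sum.cong) (auto simp: on that)
    then show ?thesis using that assms(1) by simp
  qed
  have "x \<bullet> x = (\<Sum>v\<in>B. a v * (v \<bullet> x))"
    by (subst (1) a) (simp add: inner_sum_left)
  also have "\<dots> = (\<Sum>v\<in>B. (v \<bullet> x)\<^sup>2)"
    by (rule sum.cong) (auto simp: ax power2_eq_square)
  finally show ?thesis ..
qed

section \<open>The horizontal gradient\<close>

lemma inner_ii [simp]: "(\<i> *s v) \<bullet> (\<i> *s w) = v \<bullet> (w :: complex ^ 'n)"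
  by (simp add: inner_vec_def inner_complex_def add.commute)

lemma inner_i_left: "(\<i> *s v) \<bullet> w = - (v \<bullet> (\<i> *s (w :: complex ^ 'n)))"
  by (simp add: inner_vec_def inner_complex_def flip: sum_negf)

lemma inner_i_self [simp]: "v \<bullet> (\<i> *s v) = 0" "(\<i> *s v) \<bullet> v = 0" for v :: "complex ^ 'n"
  by (simp_all add: inner_vec_def inner_complex_def)

lemma i_i [simp]: "\<i> *s (\<i> *s v) = - (v :: complex ^ 'n)"
  by (simp add: vec_eq_iff)

lemma i_linear:
  fixes v w :: "complex ^ 'n"
  shows "\<i> *s (v + w) = \<i> *s v + \<i> *s w" "\<i> *s (v - w) = \<i> *s v - \<i> *s w"
    "\<i> *s (- v) = - (\<i> *s v)" "\<i> *s (c *\<^sub>R v) = c *\<^sub>R (\<i> *s v)"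
  by (simp_all add: vec_eq_iff algebra_simps)

lemma bounded_linear_i: "bounded_linear (\<lambda>v :: complex ^ 'n. \<i> *s v)"
  by (intro linear_conv_bounded_linear[THEN iffD1] linearI) (simp_all add: i_linear)

lemma has_derivative_i [derivative_intros]:
  "(g has_derivative g') net \<Longrightarrow> ((\<lambda>x. \<i> *s (g x :: complex ^ 'n)) has_derivative (\<lambda>h. \<i> *s g' h)) net"
  by (rule bounded_linear.has_derivative[OF bounded_linear_i])

text \<open>Up to sign, the components are the derivatives of \<open>t - f\<close> along the left-invariant frame:
  \<open>y_j - \<partial>f/\<partial>x_j\<close> and \<open>- x_j - \<partial>f/\<partial>y_j\<close>.\<close>

definition horizontal_gradient :: "(complex ^ 'n::finite \<Rightarrow> real) \<Rightarrow> complex ^ 'n \<Rightarrow> complex ^ 'n" where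
  "horizontal_gradient f z = gradient f z + \<i> *s z"

lemma has_derivative_horizontal_gradient:
  assumes "C_k_on 2 f UNIV"
  shows "(horizontal_gradient f has_derivative (\<lambda>u. hessian f z u + \<i> *s u)) (at z)"
  unfolding horizontal_gradient_def[abs_def]
  by (intro derivative_intros has_derivative_hessian[OF assms]) auto

text \<open>If \<open>grad f = - \<i> z\<close> everywhere, then the Hessian would be the skew operator \<open>- \<i>\<close>.\<close>

lemma graph_has_regular_point:
  fixes f :: "complex ^ 'n::finite \<Rightarrow> real"
  assumes C2: "C_k_on 2 f UNIV"
  obtains z where "horizontal_gradient f z \<noteq> 0"
proof (rule ccontr)
  assume "\<not> thesis"
  then have "horizontal_gradient f = (\<lambda>z. 0)"
    using that by blast
  then have "(horizontal_gradient f has_derivative (\<lambda>u. 0)) (at 0)" by simp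
  then have "(\<lambda>u. hessian f 0 u + \<i> *s u) = (\<lambda>u. 0)"
    by (rule has_derivative_unique[OF has_derivative_horizontal_gradient[OF C2]])
  then have A: "hessian f 0 u = - (\<i> *s u)" for u
    by (metis eq_neg_iff_add_eq_0)
  define u :: "complex ^ 'n" where "u = axis undefined 1"
  have "u \<bullet> u = 0"
    using hessian_symmetric[OF C2 open_UNIV, of 0 u "\<i> *s u"] by (simp add: A)
  then show False by (simp add: u_def axis_eq_0_iff)
qed

section \<open>The shape operator of a graph\<close>

lemma horizontal_lift_eq: "horizontal_lift p w = (w, - ((\<i> *s fst p) \<bullet> w))"
  by (rule prod_eqI)
    (auto simp: snd_horizontal_lift inner_vec_def inner_complex_def simp flip: sum_negf intro!: sum.cong)

lemma horizontal_lift_linear: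
  "horizontal_lift p (v + w) = horizontal_lift p v + horizontal_lift p w"
  "horizontal_lift p (c *\<^sub>R v) = c *\<^sub>R horizontal_lift p v"
  "horizontal_lift p (- v) = - horizontal_lift p v"
  by (simp_all add: horizontal_lift_eq inner_add_right)

lemma contact_plane_iff: "v \<in> contact_plane p \<longleftrightarrow> snd v = - ((\<i> *s fst p) \<bullet> fst v)"
proof -
  have "contact_form p v = snd v + (\<i> *s fst p) \<bullet> fst v"
    by (simp add: contact_form_def inner_vec_def inner_complex_def algebra_simps)
  then show ?thesis by (auto simp: contact_plane_def)
qed

context
  fixes f :: "complex ^ 'n::finite \<Rightarrow> real"
  assumes C2: "C_k_on 2 f UNIV"
begin

lemma f_derivative: "(f has_derivative (\<lambda>h. gradient f z \<bullet> h)) (at z)"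
  using has_derivative_gradient C_k_on_2_differentiable(1)[OF C2] by blast

lemma graph_map_derivative:
  "((\<lambda>x. (x, f x)) has_derivative (\<lambda>u. (u, gradient f z \<bullet> u))) (at z)"
  by (intro has_derivative_Pair has_derivative_ident f_derivative)

lemma tangent_space_graph:
  "v \<in> tangent_space (heis_graph f) (z, f z) \<longleftrightarrow> snd v = gradient f z \<bullet> fst v"
proof
  assume "v \<in> tangent_space (heis_graph f) (z, f z)"
  then obtain \<gamma> \<epsilon> where \<epsilon>: "\<epsilon> > 0" and \<gamma>: "\<And>s. s \<in> {-\<epsilon><..<\<epsilon>} \<Longrightarrow> \<gamma> s \<in> heis_graph f"
    and 0: "\<gamma> 0 = (z, f z)" and d: "(\<gamma> has_derivative (\<lambda>h. h *\<^sub>R v)) (at (0::real))"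
    unfolding tangent_space_def has_vector_derivative_def by blast
  have 1: "((\<lambda>s. fst (\<gamma> s)) has_derivative (\<lambda>h. h *\<^sub>R fst v)) (at 0)"
    using has_derivative_fst[OF d] by simp
  have 2: "((\<lambda>s. snd (\<gamma> s)) has_derivative (\<lambda>h. h *\<^sub>R snd v)) (at 0)"
    using has_derivative_snd[OF d] by simp
  have "((\<lambda>s. f (fst (\<gamma> s))) has_derivative (\<lambda>h. gradient f z \<bullet> (h *\<^sub>R fst v))) (at 0)"
    by (rule has_derivative_compose[OF 1]) (simp add: 0 f_derivative)
  then have "((\<lambda>s. snd (\<gamma> s)) has_derivative (\<lambda>h. gradient f z \<bullet> (h *\<^sub>R fst v))) (at 0)"
    by (rule has_derivative_transform_within_open[of _ _ _ _ "{-\<epsilon><..<\<epsilon>}"])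
      (use \<epsilon> \<gamma> in \<open>auto simp: heis_graph_def split_beta\<close>)
  from fun_cong[OF has_derivative_unique[OF 2 this], of 1]
  show "snd v = gradient f z \<bullet> fst v" by simp
next
  assume v: "snd v = gradient f z \<bullet> fst v"
  define \<gamma> where "\<gamma> s = (z + s *\<^sub>R fst v, f (z + s *\<^sub>R fst v))" for s :: real
  have line: "((\<lambda>s. z + s *\<^sub>R fst v) has_derivative (\<lambda>h. h *\<^sub>R fst v)) (at 0)"
    by (auto intro!: derivative_eq_intros)
  have "(\<gamma> has_derivative (\<lambda>h. (h *\<^sub>R fst v, gradient f z \<bullet> (h *\<^sub>R fst v)))) (at 0)"
    unfolding \<gamma>_def
    by (rule has_derivative_compose[OF line, of "\<lambda>x. (x, f x)"]) (simp add: graph_map_derivative)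
  moreover have "(h *\<^sub>R fst v, gradient f z \<bullet> (h *\<^sub>R fst v)) = h *\<^sub>R v" for h
    using v by (auto intro!: prod_eqI)
  ultimately have "(\<gamma> has_vector_derivative v) (at 0)"
    by (simp add: has_vector_derivative_def)
  moreover have "\<gamma> s \<in> heis_graph f" for s
    by (simp add: \<gamma>_def heis_graph_def)
  moreover have "\<gamma> 0 = (z, f z)" by (simp add: \<gamma>_def)
  ultimately show "v \<in> tangent_space (heis_graph f) (z, f z)"
    unfolding tangent_space_def using zero_less_one by blast
qed

lemma horizontal_tangent_graph:
  "v \<in> horizontal_tangent (heis_graph f) (z, f z) \<longleftrightarrow>
     v = horizontal_lift (z, f z) (fst v) \<and> horizontal_gradient f z \<bullet> fst v = 0"
  unfolding horizontal_tangent_def Int_iff tangent_space_graph contact_plane_iff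
  by (auto simp: horizontal_lift_eq horizontal_gradient_def inner_add_left prod_eq_iff)

text \<open>The horizontal lift of \<open>F\<close>, the horizontal gradient, is tangent to the graph only if
  \<open>F \<bullet> F = 0\<close>.\<close>

lemma regular_point_graph:
  "regular_point (heis_graph f) (z, t) \<longleftrightarrow> t = f z \<and> horizontal_gradient f z \<noteq> 0"
proof -
  have "contact_plane (z, f z) = tangent_space (heis_graph f) (z, f z) \<longleftrightarrow> horizontal_gradient f z = 0"
  proof
    assume eq: "contact_plane (z, f z) = tangent_space (heis_graph f) (z, f z)"
    have "horizontal_lift (z, f z) (horizontal_gradient f z) \<in> horizontal_tangent (heis_graph f) (z, f z)"
      unfolding horizontal_tangent_def eq[symmetric] using horizontal_lift_in_contact_plane by blast
    then show "horizontal_gradient f z = 0"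
      unfolding horizontal_tangent_graph by simp
  next
    assume "horizontal_gradient f z = 0"
    then have "gradient f z = - (\<i> *s z)"
      by (simp add: horizontal_gradient_def eq_neg_iff_add_eq_0)
    then show "contact_plane (z, f z) = tangent_space (heis_graph f) (z, f z)"
      by (auto simp: tangent_space_graph contact_plane_iff)
  qed
  then show ?thesis
    by (auto simp: regular_point_def singular_point_def heis_graph_def)
qed

lemma xi'_graph:
  "v \<in> xi' (heis_graph f) (z, f z) \<longleftrightarrow> v = horizontal_lift (z, f z) (fst v) \<and>
     horizontal_gradient f z \<bullet> fst v = 0 \<and> (\<i> *s horizontal_gradient f z) \<bullet> fst v = 0"
proof -
  have "v \<in> J_map (z, f z) ` horizontal_tangent (heis_graph f) (z, f z) \<longleftrightarrow>
      v = horizontal_lift (z, f z) (fst v) \<and> (\<i> *s horizontal_gradient f z) \<bullet> fst v = 0"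
  proof
    assume "v \<in> J_map (z, f z) ` horizontal_tangent (heis_graph f) (z, f z)"
    then show "v = horizontal_lift (z, f z) (fst v) \<and> (\<i> *s horizontal_gradient f z) \<bullet> fst v = 0"
      by (auto simp: J_map_def horizontal_tangent_graph)
  next
    assume v: "v = horizontal_lift (z, f z) (fst v) \<and> (\<i> *s horizontal_gradient f z) \<bullet> fst v = 0"
    define u where "u = horizontal_lift (z, f z) (- (\<i> *s fst v))"
    have "v = J_map (z, f z) u"
      using v by (simp add: u_def J_map_def i_linear)
    moreover have "u \<in> horizontal_tangent (heis_graph f) (z, f z)"
      using v by (simp add: u_def horizontal_tangent_graph inner_i_left)
    ultimately show "v \<in> J_map (z, f z) ` horizontal_tangent (heis_graph f) (z, f z)" by blast
  qed
  then show ?thesis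
    unfolding xi'_def Int_iff horizontal_tangent_graph by blast
qed

definition unit_normal where
  "unit_normal z = (1 / norm (horizontal_gradient f z)) *\<^sub>R horizontal_gradient f z"

lemma unit_normal_derivative:
  assumes "horizontal_gradient f z \<noteq> 0"
  shows "(unit_normal has_derivative (\<lambda>u. (1 / norm (horizontal_gradient f z)) *\<^sub>R
     (hessian f z u + \<i> *s u - (unit_normal z \<bullet> (hessian f z u + \<i> *s u)) *\<^sub>R unit_normal z))) (at z)"
proof -
  define r where "r = norm (horizontal_gradient f z)"
  have r: "r \<noteq> 0" using assms by (simp add: r_def)
  define D where "D u = hessian f z u + \<i> *s u" for u
  have D: "(horizontal_gradient f has_derivative D) (at z)"
    using has_derivative_horizontal_gradient[OF C2] by (simp add: D_def[abs_def])
  have "((\<lambda>x. norm (horizontal_gradient f x)) has_derivative (\<lambda>u. D u \<bullet> sgn (horizontal_gradient f z))) (at z)"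
    by (rule has_derivative_compose[OF D has_derivative_norm[OF assms]])
  then have "((\<lambda>x. norm (horizontal_gradient f x)) has_derivative (\<lambda>u. unit_normal z \<bullet> D u)) (at z)"
    by (simp add: sgn_div_norm unit_normal_def inverse_eq_divide inner_commute)
  from Deriv.has_derivative_inverse[OF _ this] r
  have "((\<lambda>x. 1 / norm (horizontal_gradient f x)) has_derivative
      (\<lambda>u. - (1 / r * (unit_normal z \<bullet> D u) * (1 / r)))) (at z)"
    by (simp add: r_def inverse_eq_divide)
  from has_derivative_scaleR[OF this D]
  have "(unit_normal has_derivative (\<lambda>u. (1 / r) *\<^sub>R D u
      + (- (1 / r * (unit_normal z \<bullet> D u) * (1 / r))) *\<^sub>R horizontal_gradient f z)) (at z)"
    by (simp add: unit_normal_def[abs_def] r_def)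
  moreover have "(1 / r) *\<^sub>R D u + (- (1 / r * (unit_normal z \<bullet> D u) * (1 / r))) *\<^sub>R horizontal_gradient f z
     = (1 / r) *\<^sub>R (D u - (unit_normal z \<bullet> D u) *\<^sub>R unit_normal z)" for u
    by (simp add: unit_normal_def r_def scaleR_diff_right)
  ultimately show ?thesis by (simp add: D_def r_def)
qed

lemma unit_normal_norm:
  assumes "horizontal_gradient f z \<noteq> 0"
  shows "unit_normal z \<bullet> unit_normal z = 1"
    and "horizontal_gradient f z = norm (horizontal_gradient f z) *\<^sub>R unit_normal z"
    using assms by (simp_all add: unit_normal_def power2_norm_eq_inner[symmetric] power2_eq_square)

text \<open>The orthogonal complement of \<open>F\<close> is spanned by \<open>\<i> F\<close> and the coefficients of \<open>\<xi>'\<close>, so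
  \<open>e_n\<close> can only be a unit multiple of \<open>\<i> F\<close>.\<close>

lemma characteristic_vector:
  assumes e: "characteristic_field (heis_graph f) U e" and U: "(z, f z) \<in> U"
  shows "horizontal_gradient f z \<noteq> 0"
    and "e (z, f z) = horizontal_lift (z, f z) (fst (e (z, f z)))"
    and "fst (e (z, f z)) = (fst (e (z, f z)) \<bullet> (\<i> *s unit_normal z)) *\<^sub>R (\<i> *s unit_normal z)"
    and "(fst (e (z, f z)) \<bullet> (\<i> *s unit_normal z))\<^sup>2 = 1"
proof -
  let ?p = "(z, f z)" and ?h = "horizontal_gradient f z" and ?n = "\<i> *s unit_normal z"
  define w where "w = fst (e ?p)"
  have q: "?p \<in> heis_graph f \<inter> U" using U by (simp add: heis_graph_def)
  have "regular_point (heis_graph f) ?p"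
    and et: "e ?p \<in> horizontal_tangent (heis_graph f) ?p"
    and unit: "levi_metric (e ?p) (e ?p) = 1"
    and orth: "\<And>v. v \<in> xi' (heis_graph f) ?p \<Longrightarrow> levi_metric (e ?p) v = 0"
    using e q unfolding characteristic_field_def by blast+
  then show h: "?h \<noteq> 0" by (simp add: regular_point_graph)
  show lift: "e ?p = horizontal_lift ?p (fst (e ?p))"
    using et horizontal_tangent_graph by blast
  have hw: "?h \<bullet> w = 0"
    using et horizontal_tangent_graph by (simp add: w_def)
  have nn: "?n \<bullet> ?n = 1" using unit_normal_norm[OF h] by simp
  have hn: "?h \<bullet> ?n = 0" by (simp add: unit_normal_def i_linear)
  define w' where "w' = w - (w \<bullet> ?n) *\<^sub>R ?n"
  have "?n \<bullet> w' = 0"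
    by (simp add: w'_def inner_diff_right nn inner_commute del: inner_ii)
  then have "(\<i> *s ?h) \<bullet> w' = 0"
    using h by (simp add: unit_normal_def i_linear)
  then have "horizontal_lift ?p w' \<in> xi' (heis_graph f) ?p"
    by (simp add: xi'_graph w'_def inner_diff_right hw hn)
  then have "w \<bullet> w' = 0"
    using orth[of "horizontal_lift ?p w'"] by (simp add: levi_metric_def w_def)
  moreover have "w' \<bullet> ?n = 0"
    using \<open>?n \<bullet> w' = 0\<close> by (simp add: inner_commute)
  ultimately have "w' \<bullet> w' = 0"
    by (simp add: w'_def inner_diff_left inner_diff_right inner_commute)
  then show *: "fst (e ?p) = (fst (e ?p) \<bullet> ?n) *\<^sub>R ?n"
    by (simp add: w'_def w_def)
  have "w \<bullet> w = 1" using unit by (simp add: levi_metric_def w_def)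
  moreover have "w \<bullet> w = (w \<bullet> ?n)\<^sup>2"
    by (subst (1 2) *[folded w_def]) (use nn in \<open>simp add: power2_eq_square\<close>)
  ultimately show "(fst (e ?p) \<bullet> ?n)\<^sup>2 = 1"
    by (simp add: w_def)
qed

text \<open>The coefficient of a characteristic field with respect to \<open>\<i> F / |F|\<close> is \<open>\<plusminus>1\<close>, and it is
  continuous. So near a regular point the field is a fixed sign times a differentiable field
  on the base, whose derivative can be computed.\<close>

lemma characteristic_field_local:
  assumes e: "characteristic_field (heis_graph f) U e" and U: "(z, f z) \<in> U"
  obtains \<sigma> :: real and S where "\<sigma>\<^sup>2 = 1" "open S" "z \<in> S"
    "\<And>x. x \<in> S \<Longrightarrow> fst (e (x, f x)) = - \<sigma> *\<^sub>R (\<i> *s unit_normal x)"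
proof -
  define \<tau> where "\<tau> x = fst (e (x, f x)) \<bullet> (\<i> *s unit_normal x)" for x
  have cG: "continuous_on UNIV (\<lambda>x. (x, f x))"
    using graph_map_derivative has_derivative_continuous by (blast intro: continuous_at_imp_continuous_on)
  have "open U" using e by (simp add: characteristic_field_def)
  then have S0: "open {x. (x, f x) \<in> U}"
    using open_vimage[OF _ cG] by (simp add: vimage_def)
  have h: "horizontal_gradient f z \<noteq> 0" using characteristic_vector(1)[OF e U] .
  have "(\<lambda>q. fst (e q)) differentiable (at (z, f z) within heis_graph f)"
    using e U by (simp add: characteristic_field_def heis_graph_def)
  then obtain D where D: "((\<lambda>q. fst (e q)) has_derivative D) (at (z, f z) within heis_graph f)"
    by (auto simp: differentiable_def)
  have "range (\<lambda>x. (x, f x)) = heis_graph f"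
    by (auto simp: heis_graph_def)
  then have "((\<lambda>x. fst (e (x, f x))) has_derivative (\<lambda>u. D (u, gradient f z \<bullet> u))) (at z)"
    using has_derivative_in_compose[OF graph_map_derivative, of "\<lambda>q. fst (e q)" D z] D by simp
  then have "continuous (at z) (\<lambda>x. fst (e (x, f x)))"
    by (rule has_derivative_continuous)
  moreover have "continuous (at z) (\<lambda>x. \<i> *s unit_normal x)"
    by (rule has_derivative_continuous[OF has_derivative_i[OF unit_normal_derivative[OF h]]])
  ultimately have "continuous (at z) \<tau>"
    unfolding \<tau>_def by (rule continuous_inner)
  then obtain d where d: "d > 0" "\<And>x. dist x z < d \<Longrightarrow> dist (\<tau> x) (\<tau> z) < 1"
    unfolding continuous_at_eps_delta by (metis dist_commute zero_less_one)
  define S where "S = {x. (x, f x) \<in> U} \<inter> ball z d"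
  have sq: "(\<tau> x)\<^sup>2 = 1" if "(x, f x) \<in> U" for x
    using characteristic_vector(4)[OF e that] by (simp add: \<tau>_def)
  have "\<tau> x = \<tau> z" if "x \<in> S" for x
  proof -
    have "dist (\<tau> x) (\<tau> z) < 1" using that d by (simp add: S_def dist_commute)
    moreover have "\<tau> x = 1 \<or> \<tau> x = -1" "\<tau> z = 1 \<or> \<tau> z = -1"
      using sq[of x] sq[OF U] that by (auto simp: S_def power2_eq_1_iff)
    ultimately show ?thesis by (auto simp: dist_real_def)
  qed
  then have "fst (e (x, f x)) = - (- \<tau> z) *\<^sub>R (\<i> *s unit_normal x)" if "x \<in> S" for x
    using characteristic_vector(3)[OF e, of x] that by (simp add: \<tau>_def S_def)
  moreover have "open S" "z \<in> S" unfolding S_def using S0 U d by auto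
  ultimately show ?thesis
    using that[of "- \<tau> z" S] sq[OF U] by simp
qed

text \<open>Let \<open>N = F/|F|\<close>. For \<open>w\<close> orthogonal to \<open>F\<close> the derivative of \<open>e_{2n} = \<sigma> N\<close> is \<open>\<sigma>/|F|\<close> times the
  component of \<open>A w + \<i> w\<close> orthogonal to \<open>N\<close>. Since \<open>J' e_n = 0\<close>, the operator \<open>J'\<close> takes \<open>w\<close> to
  the component of \<open>\<i> w\<close> orthogonal to \<open>N\<close>, and \<open>\<alpha> = \<sigma>/|F|\<close>. The two skew terms cancel.\<close>

lemma shape_operator_graph:
  assumes e: "characteristic_field (heis_graph f) U e" and U: "(z, f z) \<in> U"
  obtains \<sigma> :: real where "\<sigma>\<^sup>2 = 1"
    "\<And>w. horizontal_gradient f z \<bullet> w = 0 \<Longrightarrow>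
      shape_operator (heis_graph f) e (z, f z) (horizontal_lift (z, f z) w) =
      horizontal_lift (z, f z) ((- \<sigma> / norm (horizontal_gradient f z)) *\<^sub>R
        (hessian f z w - (unit_normal z \<bullet> hessian f z w) *\<^sub>R unit_normal z))"
proof -
  let ?p = "(z, f z)" and ?h = "horizontal_gradient f z" and ?\<Sigma> = "heis_graph f"
  define r where "r = norm ?h"
  define N where "N = unit_normal z"
  obtain \<sigma> S where \<sigma>: "\<sigma>\<^sup>2 = 1" and S: "open S" "z \<in> S"
    and eS: "\<And>x. x \<in> S \<Longrightarrow> fst (e (x, f x)) = - \<sigma> *\<^sub>R (\<i> *s unit_normal x)"
    using characteristic_field_local[OF e U] by blast
  have h: "?h \<noteq> 0" using characteristic_vector(1)[OF e U] .
  have r: "r > 0" using h by (simp add: r_def)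
  have NN: "N \<bullet> N = 1" and hN: "?h = r *\<^sub>R N"
    using unit_normal_norm[OF h] by (simp_all add: N_def r_def)
  have e2n: "fst (e_2n e (x, f x)) = \<sigma> *\<^sub>R unit_normal x" if "x \<in> S" for x
    by (simp add: e_2n_def J_map_def eS[OF that] i_linear)
  have e2n_lift: "e_2n e ?p = horizontal_lift ?p (\<sigma> *\<^sub>R N)"
    using e2n[OF S(2)] by (simp add: e_2n_def J_map_def N_def)
  \<comment> \<open>The derivative of \<open>e_{2n}\<close> within the graph is determined on tangent vectors only. There it is
     recovered by composing with \<open>x \<mapsto> (x, f x)\<close>.\<close>
  define D where "D = frechet_derivative (\<lambda>q. fst (e_2n e q)) (at ?p within ?\<Sigma>)"
  have "(\<lambda>q. fst (e q)) differentiable (at ?p within ?\<Sigma>)"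
    using e U by (simp add: characteristic_field_def heis_graph_def)
  then have "(\<lambda>q. \<i> *s fst (e q)) differentiable (at ?p within ?\<Sigma>)"
    unfolding differentiable_def using has_derivative_i by blast
  then have "(\<lambda>q. fst (e_2n e q)) differentiable (at ?p within ?\<Sigma>)"
    by (simp add: e_2n_def J_map_def)
  then have D: "((\<lambda>q. fst (e_2n e q)) has_derivative D) (at ?p within ?\<Sigma>)"
    unfolding D_def using frechet_derivative_works by blast
  have "range (\<lambda>x. (x, f x)) = ?\<Sigma>"
    by (auto simp: heis_graph_def)
  then have D1: "((\<lambda>x. fst (e_2n e (x, f x))) has_derivative (\<lambda>u. D (u, gradient f z \<bullet> u))) (at z)"
    using has_derivative_in_compose[OF graph_map_derivative, of "\<lambda>q. fst (e_2n e q)" D z] D by simp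
  have D2: "((\<lambda>x. fst (e_2n e (x, f x))) has_derivative (\<lambda>u. \<sigma> *\<^sub>R ((1 / r) *\<^sub>R
     (hessian f z u + \<i> *s u - (N \<bullet> (hessian f z u + \<i> *s u)) *\<^sub>R N)))) (at z)"
    using has_derivative_scaleR_right[OF unit_normal_derivative[OF h], of \<sigma>] S
    unfolding N_def r_def
    by (rule has_derivative_transform_within_open) (simp add: e2n)
  have DN: "D (u, gradient f z \<bullet> u) = \<sigma> *\<^sub>R ((1 / r) *\<^sub>R
     (hessian f z u + \<i> *s u - (N \<bullet> (hessian f z u + \<i> *s u)) *\<^sub>R N))" for u
    by (rule fun_cong[OF has_derivative_unique[OF D1 D2]])
  have \<alpha>: "alpha ?\<Sigma> e ?p = \<sigma> / r"
  proof -
    have "a *\<^sub>R e_2n e ?p + T_field \<in> tangent_space ?\<Sigma> ?p \<longleftrightarrow> a = \<sigma> / r" for a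
    proof -
      have "a *\<^sub>R e_2n e ?p + T_field \<in> tangent_space ?\<Sigma> ?p \<longleftrightarrow> 1 = a * \<sigma> * (?h \<bullet> N)"
        by (auto simp: tangent_space_graph e2n_lift horizontal_lift_eq T_field_def horizontal_gradient_def
            inner_add_left algebra_simps)
      also have "?h \<bullet> N = r" using hN NN by simp
      also have "1 = a * \<sigma> * r \<longleftrightarrow> a = \<sigma> / r"
      proof
        assume "1 = a * \<sigma> * r"
        then have "a * r = \<sigma>" using \<sigma> by algebra
        then show "a = \<sigma> / r" using r by (simp add: field_simps)
      qed (use r \<sigma> in \<open>simp add: power2_eq_square\<close>)
      finally show ?thesis .
    qed
    then show ?thesis by (simp add: alpha_def)
  qed
  have "shape_operator ?\<Sigma> e ?p (horizontal_lift ?p w) =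
      horizontal_lift ?p ((- \<sigma> / r) *\<^sub>R (hessian f z w - (N \<bullet> hessian f z w) *\<^sub>R N))"
    if w: "?h \<bullet> w = 0" for w
  proof -
    have "horizontal_lift ?p w = (w, gradient f z \<bullet> w)"
      using w by (simp add: horizontal_lift_eq horizontal_gradient_def inner_add_left)
    then have nab: "nabla ?\<Sigma> ?p (horizontal_lift ?p w) (e_2n e) = horizontal_lift ?p (\<sigma> *\<^sub>R ((1 / r) *\<^sub>R
       (hessian f z w + \<i> *s w - (N \<bullet> (hessian f z w + \<i> *s w)) *\<^sub>R N)))"
      by (simp add: nabla_def D_def[symmetric] DN)
    have "fst (horizontal_lift ?p w - levi_metric (horizontal_lift ?p w) (e ?p) *\<^sub>R e ?p)
       = w - (w \<bullet> (\<i> *s N)) *\<^sub>R (\<i> *s N)"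
      using \<sigma> by (simp add: levi_metric_def eS[OF S(2)] N_def power2_eq_square)
    then have "J'_map e ?p (horizontal_lift ?p w)
        = horizontal_lift ?p (\<i> *s (w - (w \<bullet> (\<i> *s N)) *\<^sub>R (\<i> *s N)))"
      by (simp only: J'_map_def J_map_def)
    also have "\<i> *s (w - (w \<bullet> (\<i> *s N)) *\<^sub>R (\<i> *s N)) = \<i> *s w - (N \<bullet> (\<i> *s w)) *\<^sub>R N"
      using inner_i_left[of N w] by (simp add: i_linear inner_commute)
    finally have J': "J'_map e ?p (horizontal_lift ?p w) = horizontal_lift ?p (\<i> *s w - (N \<bullet> (\<i> *s w)) *\<^sub>R N)" .
    show ?thesis
      unfolding shape_operator_def nab J' \<alpha> horizontal_lift_linear[symmetric]
      by (rule arg_cong[where f = "horizontal_lift ?p"])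
        (simp add: inner_add_right scaleR_diff_right scaleR_add_right scaleR_add_left)
  qed
  then show ?thesis
    using that[of \<sigma>] \<sigma> by (simp add: N_def r_def)
qed

end

section \<open>Umbilic points of minimal graphs\<close>

lemma horizontal_lift_image_iff:
  "v \<in> horizontal_lift p ` W \<longleftrightarrow> v = horizontal_lift p (fst v) \<and> fst v \<in> W"
proof
  assume "v = horizontal_lift p (fst v) \<and> fst v \<in> W"
  then show "v \<in> horizontal_lift p ` W" by blast
qed auto

context
  fixes f :: "complex ^ 'n::finite \<Rightarrow> real" and z :: "complex ^ 'n"
  assumes C2: "C_k_on 2 f UNIV" and h: "horizontal_gradient f z \<noteq> 0"
begin

lemma hessian_facts: "linear (hessian f z)" "hessian f z u \<bullet> v = hessian f z v \<bullet> u"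
proof -
  show "linear (hessian f z)"
    using has_derivative_hessian[OF C2, of z] has_derivative_linear by blast
  show "hessian f z u \<bullet> v = hessian f z v \<bullet> u"
    using hessian_symmetric[OF C2 open_UNIV] by blast
qed

abbreviation (input) "Fz \<equiv> horizontal_gradient f z"
abbreviation (input) "iFz \<equiv> \<i> *s horizontal_gradient f z"

text \<open>Umbilicity in terms of the Hessian. The first claim excludes CR dimension one: an eigenvalue on
  \<open>\<xi>'\<close> requires a nonzero vector there.\<close>

lemma umbilic_point_hessian:
  assumes e: "characteristic_field (heis_graph f) U e" and U: "(z, f z) \<in> U"
    and umb: "umbilic_point (heis_graph f) e (z, f z)"
  shows "\<exists>x. x \<noteq> 0 \<and> Fz \<bullet> x = 0 \<and> iFz \<bullet> x = 0"
    and "\<exists>k. \<forall>v. Fz \<bullet> v = 0 \<longrightarrow> iFz \<bullet> v = 0 \<longrightarrow>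
      hessian f z v \<bullet> iFz = 0 \<and> (\<forall>w. Fz \<bullet> w = 0 \<longrightarrow> hessian f z v \<bullet> w = k * (v \<bullet> w))"
proof -
  let ?p = "(z, f z)" and ?\<Sigma> = "heis_graph f"
  define r where "r = norm Fz"
  define N where "N = unit_normal f z"
  have r: "r > 0" using h by (simp add: r_def)
  have NN: "N \<bullet> N = 1" and hN: "Fz = r *\<^sub>R N"
    using unit_normal_norm[OF C2 h] by (simp_all add: N_def r_def)
  obtain \<sigma> :: real where \<sigma>: "\<sigma>\<^sup>2 = 1"
    and sh: "\<And>w. Fz \<bullet> w = 0 \<Longrightarrow> shape_operator ?\<Sigma> e ?p (horizontal_lift ?p w) =
      horizontal_lift ?p ((- \<sigma> / r) *\<^sub>R (hessian f z w - (N \<bullet> hessian f z w) *\<^sub>R N))"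
    by (rule shape_operator_graph[OF C2 e U]) (rule that[unfolded N_def r_def])
  define B where "B w = (- \<sigma> / r) *\<^sub>R (hessian f z w - (N \<bullet> hessian f z w) *\<^sub>R N)" for w
  define W where "W = {w. Fz \<bullet> w = 0 \<and> iFz \<bullet> w = 0}"
  have W: "subspace W"
    by (auto simp: W_def subspace_def inner_add_right)
  have xi: "xi' ?\<Sigma> ?p = horizontal_lift ?p ` W"
  proof (rule set_eqI)
    fix v show "v \<in> xi' ?\<Sigma> ?p \<longleftrightarrow> v \<in> horizontal_lift ?p ` W"
      unfolding xi'_graph[OF C2] W_def horizontal_lift_image_iff mem_Collect_eq ..
  qed
  have inj: "horizontal_lift ?p a = horizontal_lift ?p b \<longleftrightarrow> a = b" for a b
    by (metis fst_horizontal_lift)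
  have zero: "horizontal_lift ?p 0 = 0" by (simp add: horizontal_lift_eq zero_prod_def)
  have shW: "shape_operator ?\<Sigma> e ?p (horizontal_lift ?p w) = horizontal_lift ?p (B w)" if "w \<in> W" for w
    using sh that by (simp add: W_def B_def)
  obtain k where k: "xi'_eigenvalues ?\<Sigma> e ?p = {k}" and im: "shape_operator ?\<Sigma> e ?p ` xi' ?\<Sigma> ?p \<subseteq> xi' ?\<Sigma> ?p"
    using umb by (auto simp: umbilic_point_def)
  have eig: "{l. \<exists>v\<in>W. v \<noteq> 0 \<and> B v = l *\<^sub>R v} = {k}"
  proof -
    have "xi'_eigenvalues ?\<Sigma> e ?p = {l. \<exists>v\<in>W. horizontal_lift ?p v \<noteq> horizontal_lift ?p 0 \<and>
        horizontal_lift ?p (B v) = horizontal_lift ?p (l *\<^sub>R v)}"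
      unfolding xi'_eigenvalues_def xi zero using shW by (auto simp: horizontal_lift_linear)
    then show ?thesis using k by (simp add: inj)
  qed
  then show "\<exists>x. x \<noteq> 0 \<and> Fz \<bullet> x = 0 \<and> iFz \<bullet> x = 0"
    by (auto simp: W_def)
  have BW: "B ` W \<subseteq> W"
  proof
    fix b assume "b \<in> B ` W"
    then obtain w where w: "w \<in> W" "b = B w" by blast
    then have "horizontal_lift ?p b \<in> horizontal_lift ?p ` W"
      using im shW unfolding xi by (metis image_eqI subset_iff)
    then show "b \<in> W" by (auto simp: inj)
  qed
  have lin: "linear B"
    unfolding B_def
    by (rule linearI) (simp_all add: linear_add[OF hessian_facts(1)] linear_cmul[OF hessian_facts(1)]
        inner_add_right algebra_simps)
  have B_inner: "B v \<bullet> w = - \<sigma> / r * (hessian f z v \<bullet> w)" if "Fz \<bullet> w = 0" for v w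
    using that r by (simp add: B_def hN inner_diff_left)
  have "B w = k *\<^sub>R w" if "w \<in> W" for w
  proof (rule symmetric_operator_single_eigenvalue[OF W lin BW _ eig that])
    fix u w assume "u \<in> W" "w \<in> W"
    then show "B u \<bullet> w = B w \<bullet> u"
      by (simp add: W_def B_inner hessian_facts(2)[of u w])
  qed
  then have A: "hessian f z v \<bullet> w = (- r * k * \<sigma>) * (v \<bullet> w)" if "v \<in> W" "Fz \<bullet> w = 0" for v w
  proof -
    have "- \<sigma> / r * (hessian f z v \<bullet> w) = k * (v \<bullet> w)"
      using B_inner[OF that(2), of v] \<open>\<And>w. w \<in> W \<Longrightarrow> B w = k *\<^sub>R w\<close>[OF that(1)] by simp
    then have "- (\<sigma> * (hessian f z v \<bullet> w)) = r * (k * (v \<bullet> w))"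
      using r by (simp add: field_simps)
    then show ?thesis using \<sigma> by algebra
  qed
  show "\<exists>k. \<forall>v. Fz \<bullet> v = 0 \<longrightarrow> iFz \<bullet> v = 0 \<longrightarrow>
      hessian f z v \<bullet> iFz = 0 \<and> (\<forall>w. Fz \<bullet> w = 0 \<longrightarrow> hessian f z v \<bullet> w = k * (v \<bullet> w))"
  proof (intro exI allI impI conjI)
    fix v assume v: "Fz \<bullet> v = 0" "iFz \<bullet> v = 0"
    then have "v \<in> W" by (simp add: W_def)
    from A[OF this, of iFz] v(2) show "hessian f z v \<bullet> iFz = 0" by (simp add: inner_commute)
    fix w assume "Fz \<bullet> w = 0"
    then show "hessian f z v \<bullet> w = (- r * k * \<sigma>) * (v \<bullet> w)"
      using A \<open>v \<in> W\<close> by blast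
  qed
qed

text \<open>The \<open>SOME\<close> in the definition of the trace picks an orthonormal basis because one exists; its
  frame coefficients form the basis \<open>C\<close> below.\<close>

lemma p_mean_curvature_hessian:
  assumes e: "characteristic_field (heis_graph f) U e" and U: "(z, f z) \<in> U"
    and H: "p_mean_curvature (heis_graph f) e (z, f z) = 0"
  obtains C where "finite C" "span C = {w. Fz \<bullet> w = 0}"
    "\<And>v w. v \<in> C \<Longrightarrow> w \<in> C \<Longrightarrow> v \<bullet> w = (if v = w then 1 else 0)"
    "(\<Sum>c\<in>C. hessian f z c \<bullet> c) = 0"
proof -
  let ?p = "(z, f z)" and ?\<Sigma> = "heis_graph f"
  let ?L = "horizontal_lift ?p"
  define r where "r = norm Fz"
  define N where "N = unit_normal f z"
  have r: "r > 0" using h by (simp add: r_def)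
  have hN: "Fz = r *\<^sub>R N"
    using unit_normal_norm[OF C2 h] by (simp_all add: N_def r_def)
  obtain \<sigma> :: real where \<sigma>: "\<sigma>\<^sup>2 = 1"
    and sh: "\<And>w. Fz \<bullet> w = 0 \<Longrightarrow> shape_operator ?\<Sigma> e ?p (?L w) =
      ?L ((- \<sigma> / r) *\<^sub>R (hessian f z w - (N \<bullet> hessian f z w) *\<^sub>R N))"
    by (rule shape_operator_graph[OF C2 e U]) (rule that[unfolded N_def r_def])
  define V where "V = {w. Fz \<bullet> w = 0}"
  have V: "subspace V" unfolding V_def by (rule subspace_hyperplane)
  have HT: "horizontal_tangent ?\<Sigma> ?p = ?L ` V"
  proof (rule set_eqI)
    fix v show "v \<in> horizontal_tangent ?\<Sigma> ?p \<longleftrightarrow> v \<in> ?L ` V"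
      unfolding horizontal_tangent_graph[OF C2] V_def horizontal_lift_image_iff mem_Collect_eq ..
  qed
  have L: "linear ?L" by (rule linearI) (simp_all only: horizontal_lift_linear)
  have ex: "\<exists>B. levi_orthonormal_basis (horizontal_tangent ?\<Sigma> ?p) B"
  proof -
    obtain B where B: "pairwise orthogonal B" "\<And>x. x \<in> B \<Longrightarrow> norm x = 1"
        "independent B" "span B = V"
      by (rule orthonormal_basis_subspace[OF V]) (rule that)
    have "span (?L ` B) = ?L ` V"
      by (simp only: linear_span_image[OF L] B(4))
    moreover have "finite B" using B(3) independent_imp_finite by blast
    moreover have "levi_metric (?L v) (?L w) = (if ?L v = ?L w then 1 else 0)" if "v \<in> B" "w \<in> B" for v w
    proof (cases "v = w")
      case True
      then show ?thesis using B(2)[OF that(1)] by (simp add: levi_metric_def norm_eq_1)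
    next
      case False
      then have "?L v \<noteq> ?L w" by (metis fst_horizontal_lift)
      then show ?thesis
        using B(1) that False by (simp add: levi_metric_def pairwise_def orthogonal_def)
    qed
    ultimately have "levi_orthonormal_basis (?L ` V) (?L ` B)"
      unfolding levi_orthonormal_basis_def by blast
    then show ?thesis unfolding HT ..
  qed
  define B where "B = (SOME B. levi_orthonormal_basis (horizontal_tangent ?\<Sigma> ?p) B)"
  have "levi_orthonormal_basis (horizontal_tangent ?\<Sigma> ?p) B"
    unfolding B_def using ex by (rule someI_ex)
  then have finB: "finite B" and spanB: "span B = ?L ` V"
    and on: "\<And>v w. v \<in> B \<Longrightarrow> w \<in> B \<Longrightarrow> levi_metric v w = (if v = w then 1 else 0)"
    by (auto simp: levi_orthonormal_basis_def HT)
  define C where "C = fst ` B"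
  have BL: "b = ?L (fst b) \<and> Fz \<bullet> fst b = 0" if "b \<in> B" for b
  proof -
    have "b \<in> ?L ` V" using span_base[OF that] spanB by simp
    then show ?thesis by (simp add: horizontal_lift_image_iff V_def)
  qed
  then have inj: "inj_on fst B" by (metis inj_onI)
  have "span C = fst ` span B"
    unfolding C_def by (rule linear_span_image[OF linear_fst])
  also have "\<dots> = V" by (simp add: spanB image_image)
  finally have "span C = V" .
  moreover have "finite C" using finB by (simp add: C_def)
  moreover have "v \<bullet> w = (if v = w then 1 else 0)" if vw: "v \<in> C" "w \<in> C" for v w
  proof -
    obtain a b where "a \<in> B" "b \<in> B" "v = fst a" "w = fst b"
      using vw by (auto simp: C_def)
    then show ?thesis
      using on[of a b] inj by (auto simp: levi_metric_def inj_on_def)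
  qed
  moreover have "(\<Sum>c\<in>C. hessian f z c \<bullet> c) = 0"
  proof -
    have "levi_metric (shape_operator ?\<Sigma> e ?p b) b = (- \<sigma> / r) * (hessian f z (fst b) \<bullet> fst b)" if "b \<in> B" for b
    proof -
      have b: "b = ?L (fst b)" "Fz \<bullet> fst b = 0" using BL that by blast+
      then have "N \<bullet> fst b = 0" using r by (simp add: hN)
      moreover have "shape_operator ?\<Sigma> e ?p b = ?L ((- \<sigma> / r) *\<^sub>R (hessian f z (fst b) - (N \<bullet> hessian f z (fst b)) *\<^sub>R N))"
        using sh[OF b(2)] b(1) by metis
      ultimately show ?thesis by (simp add: levi_metric_def inner_diff_left)
    qed
    then have "0 = (\<Sum>b\<in>B. (- \<sigma> / r) * (hessian f z (fst b) \<bullet> fst b))"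
      using H by (simp add: p_mean_curvature_def B_def[symmetric])
    also have "\<dots> = (- \<sigma> / r) * (\<Sum>c\<in>C. hessian f z c \<bullet> c)"
      unfolding C_def by (simp add: sum.reindex[OF inj] sum_distrib_left)
    finally show ?thesis using r \<sigma> by auto
  qed
  ultimately show ?thesis using that[of C] by (simp add: V_def)
qed

text \<open>Umbilicity leaves two numbers, \<open>k\<close> on \<open>\<xi>'\<close> and \<open>l\<close> in the direction \<open>\<i> F\<close>; in an orthonormal
  basis of the \<open>(2n-1)\<close>-dimensional horizontal tangent space the trace is
  \<open>(2n-1) k + (l - k)\<close>. The two hypotheses may come with different characteristic fields: the
  conclusions do not depend on the sign of the field.\<close>

lemma umbilic_minimal_hessian:
  assumes u: "characteristic_field (heis_graph f) U e" "(z, f z) \<in> U" "umbilic_point (heis_graph f) e (z, f z)"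
    and m: "characteristic_field (heis_graph f) U' e'" "(z, f z) \<in> U'"
      "p_mean_curvature (heis_graph f) e' (z, f z) = 0"
  shows "1 < 2 * CARD('n) - 1"
    and "\<exists>k. \<forall>v w. Fz \<bullet> v = 0 \<longrightarrow> Fz \<bullet> w = 0 \<longrightarrow> hessian f z v \<bullet> w =
      k * (v \<bullet> w) - real (2 * CARD('n) - 1) * k / (norm Fz)\<^sup>2 * ((iFz \<bullet> v) * (iFz \<bullet> w))"
proof -
  define d where "d = 2 * CARD('n) - 1"
  define V where "V = {w. Fz \<bullet> w = 0}"
  obtain x where x: "x \<noteq> 0" "Fz \<bullet> x = 0" "iFz \<bullet> x = 0"
    using umbilic_point_hessian(1)[OF u] by blast
  obtain k where k1: "\<And>v. Fz \<bullet> v = 0 \<Longrightarrow> iFz \<bullet> v = 0 \<Longrightarrow> hessian f z v \<bullet> iFz = 0"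
    and k2: "\<And>v w. Fz \<bullet> v = 0 \<Longrightarrow> iFz \<bullet> v = 0 \<Longrightarrow> Fz \<bullet> w = 0 \<Longrightarrow> hessian f z v \<bullet> w = k * (v \<bullet> w)"
    using umbilic_point_hessian(2)[OF u] by blast
  have dimV: "dim V = d"
    unfolding V_def d_def using dim_hyperplane[OF h] by simp
  define n where "n = norm Fz"
  have n: "n > 0" using h by (simp add: n_def)
  define E where "E = (1 / n) *\<^sub>R iFz"
  have EE: "E \<bullet> E = 1"
  proof -
    have "Fz \<bullet> Fz = n * n"
      by (simp add: n_def power2_eq_square flip: power2_norm_eq_inner)
    then show ?thesis using n by (simp add: E_def)
  qed
  have hE: "Fz \<bullet> E = 0" by (simp add: E_def)
  have "1 < d"
  proof -
    have "pairwise orthogonal {E, x}" "0 \<notin> {E, x}" "E \<noteq> x"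
      using x EE by (auto simp: pairwise_def orthogonal_def E_def inner_commute)
    then have "independent {E, x}" "card {E, x} = 2"
      using pairwise_orthogonal_independent by auto
    moreover have "{E, x} \<subseteq> V" using hE x by (simp add: V_def)
    ultimately show ?thesis
      using independent_card_le_dim[of "{E, x}" V] dimV by simp
  qed
  then show "1 < 2 * CARD('n) - 1" by (simp add: d_def)
  define l where "l = hessian f z E \<bullet> E"
  have form: "hessian f z v \<bullet> w = k * (v \<bullet> w) + (l - k) * ((v \<bullet> E) * (w \<bullet> E))"
    if v: "Fz \<bullet> v = 0" and w: "Fz \<bullet> w = 0" for v w
  proof -
    define v' where "v' = v - (v \<bullet> E) *\<^sub>R E"
    define w' where "w' = w - (w \<bullet> E) *\<^sub>R E"
    have v': "Fz \<bullet> v' = 0" "iFz \<bullet> v' = 0" and w': "Fz \<bullet> w' = 0" "iFz \<bullet> w' = 0"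
    proof -
      show "Fz \<bullet> v' = 0" "Fz \<bullet> w' = 0"
        using v w hE by (simp_all add: v'_def w'_def inner_diff_right)
      have "E \<bullet> v' = 0" "E \<bullet> w' = 0"
        using EE by (simp_all add: v'_def w'_def inner_diff_right inner_commute)
      then show "iFz \<bullet> v' = 0" "iFz \<bullet> w' = 0" using n by (simp_all add: E_def)
    qed
    have AE: "hessian f z v' \<bullet> E = 0" "hessian f z w' \<bullet> E = 0"
      using k1[OF v'] k1[OF w'] by (simp_all add: E_def)
    have vv: "v = v' + (v \<bullet> E) *\<^sub>R E" and ww: "w = w' + (w \<bullet> E) *\<^sub>R E"
      by (simp_all add: v'_def w'_def)
    have "hessian f z v \<bullet> w = hessian f z v' \<bullet> w + (v \<bullet> E) * (hessian f z E \<bullet> w)"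
      by (subst vv) (simp only: linear_add[OF hessian_facts(1)] linear_cmul[OF hessian_facts(1)]
          inner_add_left inner_scaleR_left)
    also have "hessian f z v' \<bullet> w = k * (v' \<bullet> w)"
      using k2[OF v' w] .
    also have "v' \<bullet> w = v \<bullet> w - (v \<bullet> E) * (w \<bullet> E)"
      by (simp add: v'_def inner_diff_left inner_commute[of E w])
    also have "hessian f z E \<bullet> w = hessian f z w \<bullet> E" by (rule hessian_facts)
    also have "\<dots> = hessian f z w' \<bullet> E + (w \<bullet> E) * l"
      unfolding l_def by (subst ww) (simp only: linear_add[OF hessian_facts(1)] linear_cmul[OF hessian_facts(1)]
          inner_add_left inner_scaleR_left)
    finally show ?thesis using AE by (simp add: algebra_simps)
  qed
  obtain C where C: "finite C" "span C = V"
    and on: "\<And>v w. v \<in> C \<Longrightarrow> w \<in> C \<Longrightarrow> v \<bullet> w = (if v = w then 1 else 0)"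
    and tr: "(\<Sum>c\<in>C. hessian f z c \<bullet> c) = 0"
    using p_mean_curvature_hessian[OF m] unfolding V_def by blast
  have "card C = d"
  proof -
    have "pairwise orthogonal C" "0 \<notin> C"
      using on by (fastforce simp: pairwise_def orthogonal_def split: if_splits)+
    then have "independent C" by (rule pairwise_orthogonal_independent)
    then show ?thesis using dimV C(2) indep_card_eq_dim_span by metis
  qed
  have CV: "Fz \<bullet> c = 0" if "c \<in> C" for c
    using that C(2) span_superset by (auto simp: V_def)
  have "0 = (\<Sum>c\<in>C. k + (l - k) * (c \<bullet> E)\<^sup>2)"
    unfolding tr[symmetric] by (rule sum.cong) (simp_all add: form CV on power2_eq_square)
  also have "\<dots> = real d * k + (l - k) * (\<Sum>c\<in>C. (c \<bullet> E)\<^sup>2)"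
    by (simp add: sum.distrib \<open>card C = d\<close> sum_distrib_left)
  also have "(\<Sum>c\<in>C. (c \<bullet> E)\<^sup>2) = 1"
    using orthonormal_sum_inner_squares[OF C(1) on, of E] hE EE C(2) by (simp add: V_def)
  finally have lk: "l - k = - (real d * k)" by simp
  show "\<exists>k. \<forall>v w. Fz \<bullet> v = 0 \<longrightarrow> Fz \<bullet> w = 0 \<longrightarrow> hessian f z v \<bullet> w =
      k * (v \<bullet> w) - real (2 * CARD('n) - 1) * k / (norm Fz)\<^sup>2 * ((iFz \<bullet> v) * (iFz \<bullet> w))"
  proof (intro exI allI impI)
    fix v w assume "Fz \<bullet> v = 0" "Fz \<bullet> w = 0"
    from form[OF this] show "hessian f z v \<bullet> w =
      k * (v \<bullet> w) - real (2 * CARD('n) - 1) * k / (norm Fz)\<^sup>2 * ((iFz \<bullet> v) * (iFz \<bullet> w))"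
      unfolding lk d_def[symmetric] n_def[symmetric]
      by (simp add: E_def power2_eq_square inner_commute)
  qed
qed

end

section \<open>Structure equations\<close>

lemma one_plus_square: "1 + (x::real)\<^sup>2 > 0" "1 + (x::real)\<^sup>2 \<noteq> 0"
  by (smt (verit) zero_le_power2)+

lemma hessian_decomposition_algebra:
  fixes s :: real
  assumes "s \<noteq> 0"
  shows "k * (vw - a * b / s) - e + b / s * p + a / s * r - a / s * (b / s) * t
    = k * vw - e + a * (1 / s * (r - k * b - (t / s - k) / 2 * b)) + 1 / s * (p - k * a - (t / s - k) / 2 * a) * b"
  using assms by (simp add: divide_simps) algebra

text \<open>From here on only the Hessian form of the curvature conditions is used; \<open>M\<close> stands for \<open>2n - 1\<close>.\<close>

locale umbilic_minimal_graph =
  fixes f :: "complex ^ 'n::finite \<Rightarrow> real" and M :: nat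
  assumes C2: "C_k_on 2 f UNIV"
    and C3: "C_k_on 3 f {z. horizontal_gradient f z \<noteq> 0}"
    and M: "1 < M"
    and nontrivial: "\<And>z. horizontal_gradient f z \<noteq> 0 \<Longrightarrow>
      \<exists>x. x \<noteq> 0 \<and> horizontal_gradient f z \<bullet> x = 0 \<and> (\<i> *s horizontal_gradient f z) \<bullet> x = 0"
    and umbilic_form: "\<And>z. horizontal_gradient f z \<noteq> 0 \<Longrightarrow>
      \<exists>k. \<forall>v w. horizontal_gradient f z \<bullet> v = 0 \<longrightarrow> horizontal_gradient f z \<bullet> w = 0 \<longrightarrow>
        hessian f z v \<bullet> w = k * (v \<bullet> w) - real M * k / (norm (horizontal_gradient f z))\<^sup>2 *
          (((\<i> *s horizontal_gradient f z) \<bullet> v) * ((\<i> *s horizontal_gradient f z) \<bullet> w))"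
begin

abbreviation "m \<equiv> real M"
abbreviation "A \<equiv> hessian f"
definition F where "F = horizontal_gradient f"
definition E where "E z = \<i> *s F z"
definition s where "s z = F z \<bullet> F z"
definition R where "R = {z. F z \<noteq> 0}"
text \<open>The unknown factor \<open>k\<close> of \<open>umbilic_form\<close>, expressed by the value of the Hessian form at \<open>E\<close>.
  In this form it is visibly differentiable.\<close>

definition \<kappa> where "\<kappa> z = A z (E z) \<bullet> E z / ((1 - m) * s z)"
definition q where "q z = m * \<kappa> z / s z"
definition V where "V z = E z - \<kappa> z *\<^sub>R F z"
abbreviation "DF z u \<equiv> A z u + \<i> *s u"

lemma m: "m \<noteq> 1"
  using M by simp

lemma F_derivative: "(F has_derivative DF z) (at z)"
  unfolding F_def by (rule has_derivative_horizontal_gradient[OF C2])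

lemma E_derivative: "(E has_derivative (\<lambda>u. \<i> *s DF z u)) (at z)"
  unfolding E_def[abs_def] by (rule has_derivative_i[OF F_derivative])

lemma open_R: "open R"
proof -
  have "continuous_on UNIV F"
    using F_derivative has_derivative_continuous by (blast intro: continuous_at_imp_continuous_on)
  then show ?thesis
    by (simp add: R_def Collect_neg_eq closed_Collect_eq open_Compl)
qed

lemma s_pos: "z \<in> R \<Longrightarrow> s z > 0"
  by (simp add: R_def s_def)

lemma E_simps [simp]: "E z \<bullet> F z = 0" "F z \<bullet> E z = 0" "E z \<bullet> E z = s z" "F z \<bullet> F z = s z"
  "\<i> *s F z = E z" "\<i> *s E z = - F z"
  by (simp_all add: E_def s_def)

lemma A_linear: "A z (v + w) = A z v + A z w" "A z (v - w) = A z v - A z w"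
  "A z (c *\<^sub>R v) = c *\<^sub>R A z v" "A z (- v) = - A z v"
proof -
  interpret bounded_linear "A z"
    using has_derivative_hessian[OF C2, of z] has_derivative_bounded_linear by blast
  show "A z (v + w) = A z v + A z w" "A z (v - w) = A z v - A z w"
  "A z (c *\<^sub>R v) = c *\<^sub>R A z v" "A z (- v) = - A z v"
    by (rule add diff scaleR neg)+
qed

lemma A_sym: "A z v \<bullet> w = A z w \<bullet> v"
  using hessian_symmetric[OF C2 open_UNIV] by auto

lemma hessian_on_horizontal_tangent:
  assumes "z \<in> R" "F z \<bullet> v = 0" "F z \<bullet> w = 0"
  shows "A z v \<bullet> w = \<kappa> z * (v \<bullet> w) - q z * ((E z \<bullet> v) * (E z \<bullet> w))"
proof -
  have F: "F z \<noteq> 0" using assms by (simp add: R_def)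
  obtain k where k: "\<And>v w. F z \<bullet> v = 0 \<Longrightarrow> F z \<bullet> w = 0 \<Longrightarrow>
      A z v \<bullet> w = k * (v \<bullet> w) - m * k / s z * ((E z \<bullet> v) * (E z \<bullet> w))"
    using umbilic_form[of z] F unfolding F_def[symmetric] by (auto simp: power2_norm_eq_inner)
  have "A z (E z) \<bullet> E z = k * s z - m * k / s z * (s z * s z)"
    by (subst k) auto
  also have "\<dots> = (1 - m) * s z * k"
    using s_pos[OF assms(1)] by (simp add: field_simps)
  finally have "\<kappa> z = k"
    using m s_pos[OF assms(1)] by (simp add: \<kappa>_def)
  then show ?thesis using k[OF assms(2,3)] by (simp add: q_def)
qed

text \<open>The part of the Hessian that the curvature conditions leave free is \<open>F \<otimes> \<beta> + \<beta> \<otimes> F\<close>. Testing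
  \<open>hessian_decomposition\<close> with \<open>v = F\<close> forces this \<open>\<beta>\<close>; the last summand accounts for the
  component \<open>\<beta> \<bullet> F\<close>, which is counted twice.\<close>

definition \<beta> where
  "\<beta> z = (1 / s z) *\<^sub>R (A z (F z) - \<kappa> z *\<^sub>R F z - ((A z (F z) \<bullet> F z / s z - \<kappa> z) / 2) *\<^sub>R F z)"

lemma hessian_decomposition:
  assumes "z \<in> R"
  shows "A z v \<bullet> w = \<kappa> z * (v \<bullet> w) - q z * ((E z \<bullet> v) * (E z \<bullet> w))
    + (F z \<bullet> v) * (\<beta> z \<bullet> w) + (\<beta> z \<bullet> v) * (F z \<bullet> w)"
proof -
  note s = s_pos[OF assms]
  define v' where "v' = v - (F z \<bullet> v / s z) *\<^sub>R F z"
  define w' where "w' = w - (F z \<bullet> w / s z) *\<^sub>R F z"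
  have "F z \<bullet> v' = 0" "F z \<bullet> w' = 0"
    using s by (simp_all add: v'_def w'_def inner_diff_right)
  from hessian_on_horizontal_tangent[OF assms this]
  have *: "A z v' \<bullet> w' = \<kappa> z * (v' \<bullet> w') - q z * ((E z \<bullet> v') * (E z \<bullet> w'))" .
  have "A z v' \<bullet> w' = A z v \<bullet> w - F z \<bullet> w / s z * (A z v \<bullet> F z) - F z \<bullet> v / s z * (A z (F z) \<bullet> w)
      + F z \<bullet> v / s z * (F z \<bullet> w / s z) * (A z (F z) \<bullet> F z)"
    by (simp add: v'_def w'_def A_linear inner_diff_left inner_diff_right algebra_simps)
  moreover have "v' \<bullet> w' = v \<bullet> w - (F z \<bullet> v) * (F z \<bullet> w) / s z"
    using s by (simp add: v'_def w'_def inner_diff_left inner_diff_right inner_commute field_simps)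
  moreover have "E z \<bullet> v' = E z \<bullet> v" "E z \<bullet> w' = E z \<bullet> w"
    by (simp_all add: v'_def w'_def inner_diff_right)
  moreover have "A z v \<bullet> F z = A z (F z) \<bullet> v" by (rule A_sym)
  ultimately have "A z v \<bullet> w = \<kappa> z * (v \<bullet> w - (F z \<bullet> v) * (F z \<bullet> w) / s z) - q z * ((E z \<bullet> v) * (E z \<bullet> w))
     + F z \<bullet> w / s z * (A z (F z) \<bullet> v) + F z \<bullet> v / s z * (A z (F z) \<bullet> w)
      - F z \<bullet> v / s z * (F z \<bullet> w / s z) * (A z (F z) \<bullet> F z)"
    using * by simp
  also have "\<dots> = \<kappa> z * (v \<bullet> w) - q z * ((E z \<bullet> v) * (E z \<bullet> w))
    + (F z \<bullet> v) * (\<beta> z \<bullet> w) + (\<beta> z \<bullet> v) * (F z \<bullet> w)"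
    unfolding \<beta>_def inner_diff_left inner_scaleR_left
    by (rule hessian_decomposition_algebra) (use s in simp)
  finally show ?thesis .
qed

lemma A_differentiable:
  assumes "z \<in> R" "g differentiable (at z)"
  shows "(\<lambda>x. A x (g x)) differentiable (at z)"
proof -
  have C: "C_k_on 3 f R" using C3 by (simp add: R_def F_def)
  have "A x (g x) = (\<Sum>b\<in>Basis. (g x \<bullet> b) *\<^sub>R A x b)" for x
  proof -
    interpret bounded_linear "A x"
      using has_derivative_hessian[OF C2, of x] has_derivative_bounded_linear by blast
    show ?thesis
      by (subst (1) euclidean_representation[of "g x", symmetric]) (simp only: sum scaleR)
  qed
  moreover have "(\<lambda>x. \<Sum>b\<in>Basis. (g x \<bullet> b) *\<^sub>R A x b) differentiable (at z)"
    by (intro differentiable_sum differentiable_scaleR hessian_differentiable[OF C open_R]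
        differentiable_inner assms differentiable_const finite_Basis ballI)
  ultimately show ?thesis by simp
qed

lemma F_E_s_differentiable: "F differentiable (at z)" "E differentiable (at z)" "s differentiable (at z)"
proof -
  show F: "F differentiable (at z)"
    using F_derivative differentiable_def by blast
  then show "s differentiable (at z)"
    unfolding s_def[abs_def] by (intro differentiable_inner)
  show "E differentiable (at z)"
    unfolding E_def[abs_def] differentiable_def by (rule exI, rule has_derivative_i, rule F_derivative)
qed

lemma invariants_differentiable:
  assumes "z \<in> R"
  shows "\<kappa> differentiable (at z)" "q differentiable (at z)" "\<beta> differentiable (at z)"
proof -
  have s: "s z \<noteq> 0" using s_pos[OF assms] by simp
  have AF: "(\<lambda>x. A x (F x)) differentiable (at z)" and AE: "(\<lambda>x. A x (E x)) differentiable (at z)"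
    by (rule A_differentiable[OF assms] F_E_s_differentiable)+
  have 1: "(\<lambda>z. 1 / s z) differentiable (at z)"
    by (rule differentiable_divide[OF differentiable_const F_E_s_differentiable(3) s])
  have 2: "(\<lambda>z. A z (E z) \<bullet> E z) differentiable (at z)" "(\<lambda>z. A z (F z) \<bullet> F z) differentiable (at z)"
    by (rule differentiable_inner AF AE F_E_s_differentiable)+
  have \<kappa>: "(\<lambda>z. A z (E z) \<bullet> E z / ((1 - m) * s z)) differentiable (at z)"
    using s m 2 by (intro differentiable_divide differentiable_mult differentiable_const F_E_s_differentiable) auto
  then show \<kappa>: "\<kappa> differentiable (at z)"
    unfolding \<kappa>_def[abs_def] .
  have "(\<lambda>z. m * \<kappa> z / s z) differentiable (at z)"
    by (rule differentiable_divide differentiable_mult differentiable_const F_E_s_differentiable \<kappa> s)+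
  then show "q differentiable (at z)"
    unfolding q_def[abs_def] .
  have 3: "(\<lambda>z. (A z (F z) \<bullet> F z / s z - \<kappa> z) / 2) differentiable (at z)"
    using 2 s \<kappa> F_E_s_differentiable by (intro differentiable_divide differentiable_diff differentiable_const) auto
  have "(\<lambda>z. (1 / s z) *\<^sub>R (A z (F z) - \<kappa> z *\<^sub>R F z
      - ((A z (F z) \<bullet> F z / s z - \<kappa> z) / 2) *\<^sub>R F z)) differentiable (at z)"
    by (rule differentiable_scaleR 1 differentiable_diff AF \<kappa> F_E_s_differentiable 3)+
  then show "\<beta> differentiable (at z)"
    unfolding \<beta>_def[abs_def] .
qed

abbreviation "T \<equiv> third_derivative f"

text \<open>Any formula for \<open>A v \<bullet> w\<close> that is valid on the regular set can be differentiated to compute the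
  third derivative.\<close>

lemma T_unique:
  assumes "z \<in> R" "\<And>x. x \<in> R \<Longrightarrow> A x v \<bullet> w = g x" "(g has_derivative g') (at z)"
  shows "T z u v w = g' u"
proof -
  have C: "C_k_on 3 f R" using C3 by (simp add: R_def F_def)
  have "((\<lambda>x. A x v \<bullet> w) has_derivative g') (at z)"
    using assms(3) open_R assms(1) by (rule has_derivative_transform_within_open) (simp add: assms(2))
  then show ?thesis
    by (rule fun_cong[OF has_derivative_unique[OF has_derivative_third_derivative[OF C open_R assms(1)]]])
qed

lemma T_symmetric:
  assumes "z \<in> R"
  shows "T z u v w = T z u w v" "T z u v w = T z v u w"
proof -
  have C: "C_k_on 3 f R" using C3 by (simp add: R_def F_def)
  show "T z u v w = T z u w v" "T z u v w = T z v u w"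
    by (rule third_derivative_symmetric[OF C open_R assms])+
qed

text \<open>The frame coefficients of \<open>\<xi>'\<close>.\<close>

definition xi where "xi z = {x. F z \<bullet> x = 0 \<and> E z \<bullet> x = 0}"

lemma xi_closed:
  assumes "x \<in> xi z"
  shows "F z \<bullet> x = 0" "x \<bullet> F z = 0" "E z \<bullet> x = 0" "x \<bullet> E z = 0" "\<i> *s x \<in> xi z"
proof -
  show *: "F z \<bullet> x = 0" "x \<bullet> F z = 0" "E z \<bullet> x = 0" "x \<bullet> E z = 0"
    using assms by (auto simp: xi_def inner_commute)
  have "F z \<bullet> (\<i> *s x) = - (E z \<bullet> x)" "E z \<bullet> (\<i> *s x) = F z \<bullet> x"
    by (simp_all add: E_def inner_i_left del: E_simps)
  then show "\<i> *s x \<in> xi z"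
    using * by (simp add: xi_def)
qed

text \<open>These are the Codazzi equations within the horizontal tangent space: the derivative of
  \<open>hessian_decomposition\<close> must be symmetric in its three arguments. With \<open>x\<close> in \<open>\<xi>'\<close>, the
  exchanges \<open>T(x, \<i> x, E) = T(\<i> x, x, E)\<close>, \<open>T(x, x, E) = T(E, x, x)\<close>,
  \<open>T(x, E, E) = T(E, x, E)\<close> and \<open>T(x, \<i> x, x) = T(\<i> x, x, x)\<close> give in turn \<open>\<beta> \<bullet> E\<close>, \<open>d\<kappa>(E)\<close>, the
  relation \<open>d\<kappa>(x) = \<kappa> (\<beta> \<bullet> x)\<close>, and \<open>\<beta> \<bullet> x = 0\<close>. Only the antisymmetric part \<open>\<i>\<close> of \<open>DF\<close>
  makes the first and the last of them informative.\<close>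

lemma codazzi_tangential:
  assumes z: "z \<in> R" and d\<kappa>: "(\<kappa> has_derivative d\<kappa>) (at z)"
  shows "\<beta> z \<bullet> E z = m * (\<kappa> z)\<^sup>2"
    and "d\<kappa> (E z) = m * \<kappa> z * (1 + (\<kappa> z)\<^sup>2)"
    and "x \<in> xi z \<Longrightarrow> \<beta> z \<bullet> x = 0 \<and> d\<kappa> x = 0"
proof -
  note s = s_pos[OF z]
  define D where "D u = DF z u" for u
  have F': "(F has_derivative D) (at z)" and E': "(E has_derivative (\<lambda>u. \<i> *s D u)) (at z)"
    using F_derivative[of z] E_derivative[of z] by (simp_all add: D_def[abs_def])
  obtain dq where dq: "(q has_derivative dq) (at z)"
    using invariants_differentiable(2)[OF z] by (auto simp: differentiable_def)
  obtain d\<beta> where d\<beta>: "(\<beta> has_derivative d\<beta>) (at z)"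
    using invariants_differentiable(3)[OF z] by (auto simp: differentiable_def)
  have qs: "q z * s z = m * \<kappa> z" using s by (simp add: q_def)
  have dqs: "dq u * s z + 2 * q z * (D u \<bullet> F z) = m * d\<kappa> u" for u
  proof -
    have 1: "((\<lambda>x. q x * (F x \<bullet> F x)) has_derivative
        (\<lambda>u. q z * (F z \<bullet> D u + D u \<bullet> F z) + dq u * (F z \<bullet> F z))) (at z)"
      by (intro has_derivative_mult has_derivative_inner dq F')
    have 2: "((\<lambda>x. q x * (F x \<bullet> F x)) has_derivative (\<lambda>u. m * d\<kappa> u)) (at z)"
      using has_derivative_mult_right[OF d\<kappa>, of m] open_R z
      by (rule has_derivative_transform_within_open) (simp add: q_def s_pos less_imp_neq[THEN not_sym])
    show ?thesis
      using fun_cong[OF has_derivative_unique[OF 1 2], of u] by (simp add: inner_commute[of "F z"])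
  qed
  have T: "T z u v w = d\<kappa> u * (v \<bullet> w) - (dq u * ((E z \<bullet> v) * (E z \<bullet> w))
      + q z * (((\<i> *s D u) \<bullet> v) * (E z \<bullet> w) + (E z \<bullet> v) * ((\<i> *s D u) \<bullet> w)))
      + ((D u \<bullet> v) * (\<beta> z \<bullet> w) + (F z \<bullet> v) * (d\<beta> u \<bullet> w))
      + ((d\<beta> u \<bullet> v) * (F z \<bullet> w) + (\<beta> z \<bullet> v) * (D u \<bullet> w))" for u v w
    by (rule T_unique[OF z hessian_decomposition, of _ _ "\<lambda>u. d\<kappa> u * (v \<bullet> w) - (dq u * ((E z \<bullet> v) * (E z \<bullet> w))
      + q z * (((\<i> *s D u) \<bullet> v) * (E z \<bullet> w) + (E z \<bullet> v) * ((\<i> *s D u) \<bullet> w)))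
      + ((D u \<bullet> v) * (\<beta> z \<bullet> w) + (F z \<bullet> v) * (d\<beta> u \<bullet> w))
      + ((d\<beta> u \<bullet> v) * (F z \<bullet> w) + (\<beta> z \<bullet> v) * (D u \<bullet> w))"])
      (rule derivative_eq_intros d\<kappa> dq d\<beta> F' E' refl | simp add: fun_eq_iff algebra_simps)+
  note T = T[unfolded inner_i_left]
  have DF_xi: "D x \<bullet> y = \<kappa> z * (x \<bullet> y) + (\<i> *s x) \<bullet> y" "D x \<bullet> E z = 0"
     "D x \<bullet> F z = s z * (\<beta> z \<bullet> x)" "D (E z) \<bullet> x = 0" if "x \<in> xi z" "y \<in> xi z" for x y
    using xi_closed[OF that(1)] xi_closed[OF that(2)]
    by (simp_all add: D_def inner_add_left inner_diff_left hessian_decomposition[OF z] inner_i_left[of x])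
  have DFEE: "D (E z) \<bullet> E z = (1 - m) * \<kappa> z * s z"
    using qs by (simp add: D_def inner_diff_left hessian_decomposition[OF z] algebra_simps)
  have *: "\<beta> z \<bullet> E z = m * (\<kappa> z)\<^sup>2 \<and> d\<kappa> (E z) = m * \<kappa> z * (1 + (\<kappa> z)\<^sup>2) \<and> \<beta> z \<bullet> x = 0 \<and> d\<kappa> x = 0"
    if x: "x \<in> xi z" and "x \<noteq> 0" for x
  proof -
    define N where "N = x \<bullet> x"
    have N: "N > 0" using \<open>x \<noteq> 0\<close> by (simp add: N_def)
    note y = xi_closed(5)[OF x]
    note DX = DF_xi[OF x x] DF_xi[OF x y] DF_xi[OF y x] DF_xi[OF y y] DFEE
    note xs = xi_closed[OF x] xi_closed[OF y]
    note S = T DX xs inner_i_left[of x x] N_def[symmetric]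
    have 1: "T z x (\<i> *s x) (E z) = N * (\<beta> z \<bullet> E z) - q z * s z * \<kappa> z * N"
      by (simp add: S)
    have 2: "T z (\<i> *s x) x (E z) = - N * (\<beta> z \<bullet> E z) + q z * s z * \<kappa> z * N"
      by (simp add: S)
    have "N * (\<beta> z \<bullet> E z - m * (\<kappa> z)\<^sup>2) = 0"
      using 1[unfolded qs] 2[unfolded qs] T_symmetric(2)[OF z, of x "\<i> *s x" "E z"] by algebra
    then have \<beta>E: "\<beta> z \<bullet> E z = m * (\<kappa> z)\<^sup>2" using N by simp
    have 3: "T z x x (E z) = q z * s z * N + \<kappa> z * N * (\<beta> z \<bullet> E z)"
      by (simp add: S)
    have 4: "T z (E z) x x = d\<kappa> (E z) * N"
      by (simp add: S)
    have "T z x x (E z) = T z (E z) x x"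
      using T_symmetric[OF z] by metis
    then have "N * (d\<kappa> (E z) - m * \<kappa> z * (1 + (\<kappa> z)\<^sup>2)) = 0"
      using 3[unfolded qs] 4 \<beta>E by algebra
    then have dE: "d\<kappa> (E z) = m * \<kappa> z * (1 + (\<kappa> z)\<^sup>2)" using N by simp
    have 5: "T z y (E z) (E z) = d\<kappa> y * s z - dq y * (s z * s z) - 2 * q z * s z * (s z * (\<beta> z \<bullet> y))"
      if "y \<in> xi z" for y
      using xi_closed[OF that] DF_xi[OF that that] by (simp add: T)
    have 6: "T z (E z) y (E z) = (\<beta> z \<bullet> y) * ((1 - m) * \<kappa> z * s z)" if "y \<in> xi z" for y
      using xi_closed[OF that] DF_xi[OF that that] DF_xi(4)[OF xi_closed(5)[OF that] that]
      by (simp add: T DFEE)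
    have d\<kappa>_xi: "d\<kappa> y = \<kappa> z * (\<beta> z \<bullet> y)" if y: "y \<in> xi z" for y
    proof -
      have "dq y * s z = m * d\<kappa> y - 2 * q z * (s z * (\<beta> z \<bullet> y))"
        using dqs[of y] DF_xi(3)[OF y y] by simp
      then have "T z y (E z) (E z) = (1 - m) * s z * d\<kappa> y"
        unfolding 5[OF y] using qs by algebra
      moreover have "T z y (E z) (E z) = T z (E z) y (E z)"
        using T_symmetric[OF z] by metis
      ultimately have "((1 - m) * s z) * (d\<kappa> y - \<kappa> z * (\<beta> z \<bullet> y)) = 0"
        unfolding 6[OF y] by algebra
      then show ?thesis using m s by simp
    qed
    have 7: "T z x (\<i> *s x) x = N * (\<beta> z \<bullet> x) + \<kappa> z * N * (\<beta> z \<bullet> (\<i> *s x))"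
      by (simp add: S)
    have 8: "T z (\<i> *s x) x x = d\<kappa> (\<i> *s x) * N - 2 * N * (\<beta> z \<bullet> x)"
      by (simp add: S)
    have "N * (\<beta> z \<bullet> x) = 0"
      using 7 8 T_symmetric(2)[OF z, of x "\<i> *s x" x] d\<kappa>_xi[OF y] by algebra
    then have "\<beta> z \<bullet> x = 0" using N by simp
    then show ?thesis using \<beta>E dE d\<kappa>_xi[OF x] by simp
  qed
  obtain x0 where "x0 \<in> xi z" "x0 \<noteq> 0"
    using nontrivial[of z] z by (auto simp: R_def xi_def E_def F_def)
  from *[OF this] show "\<beta> z \<bullet> E z = m * (\<kappa> z)\<^sup>2" "d\<kappa> (E z) = m * \<kappa> z * (1 + (\<kappa> z)\<^sup>2)" by auto
  have "d\<kappa> 0 = 0"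
    using d\<kappa> has_derivative_bounded_linear linear_simps(3) by blast
  then show "x \<in> xi z \<Longrightarrow> \<beta> z \<bullet> x = 0 \<and> d\<kappa> x = 0"
    using *[of x] by (cases "x = 0") auto
qed

lemma xi_decomposition:
  assumes "z \<in> R"
  obtains x where "x \<in> xi z" "w = (F z \<bullet> w / s z) *\<^sub>R F z + (E z \<bullet> w / s z) *\<^sub>R E z + x"
proof
  note s = s_pos[OF assms]
  let ?x = "w - (F z \<bullet> w / s z) *\<^sub>R F z - (E z \<bullet> w / s z) *\<^sub>R E z"
  show "?x \<in> xi z"
    using s by (simp add: xi_def inner_diff_right)
  show "w = (F z \<bullet> w / s z) *\<^sub>R F z + (E z \<bullet> w / s z) *\<^sub>R E z + ?x" by simp
qed

text \<open>The coefficient of \<open>F \<otimes> F\<close> in the Hessian.\<close>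

definition c where "c z = (A z (F z) \<bullet> F z / s z - \<kappa> z) / s z"

lemma \<beta>_eq:
  assumes z: "z \<in> R"
  shows "\<beta> z \<bullet> w = (\<kappa> z * q z) * (E z \<bullet> w) + c z / 2 * (F z \<bullet> w)"
proof -
  note s = s_pos[OF z]
  obtain d\<kappa> where d\<kappa>: "(\<kappa> has_derivative d\<kappa>) (at z)"
    using invariants_differentiable(1)[OF z] by (auto simp: differentiable_def)
  note st = codazzi_tangential[OF z d\<kappa>]
  obtain x where x: "x \<in> xi z" and w: "w = (F z \<bullet> w / s z) *\<^sub>R F z + (E z \<bullet> w / s z) *\<^sub>R E z + x"
    using xi_decomposition[OF z] .
  have \<beta>F: "\<beta> z \<bullet> F z = s z * (c z / 2)"
    using s unfolding \<beta>_def c_def inner_diff_left inner_scaleR_left E_simps by (simp add: field_simps)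
  have \<beta>E: "\<beta> z \<bullet> E z = s z * (\<kappa> z * q z)"
    using s st(1) by (simp add: q_def power2_eq_square)
  have "\<beta> z \<bullet> x = 0" using st(3)[OF x] by simp
  then have "\<beta> z \<bullet> ((F z \<bullet> w / s z) *\<^sub>R F z + (E z \<bullet> w / s z) *\<^sub>R E z + x)
     = (\<kappa> z * q z) * (E z \<bullet> w) + c z / 2 * (F z \<bullet> w)"
    using s unfolding inner_add_right inner_scaleR_right \<beta>F \<beta>E by simp
  then show ?thesis using w by simp
qed

lemma hessian_decomposition_explicit:
  assumes "z \<in> R"
  shows "A z v \<bullet> w = \<kappa> z * (v \<bullet> w) - q z * ((E z \<bullet> v) * (E z \<bullet> w))
    + \<kappa> z * q z * ((F z \<bullet> v) * (E z \<bullet> w) + (E z \<bullet> v) * (F z \<bullet> w)) + c z * ((F z \<bullet> v) * (F z \<bullet> w))"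
  unfolding hessian_decomposition[OF assms] \<beta>_eq[OF assms] by (simp add: algebra_simps)

text \<open>Now \<open>\<beta>\<close> is known except for its component along \<open>F\<close>. With \<open>x\<close> in \<open>\<xi>'\<close>, the exchange
  \<open>T(x, \<i> x, F) = T(\<i> x, x, F)\<close> determines this component, and \<open>T(x, x, F) = T(F, x, x)\<close>
  determines \<open>d\<kappa>(F)\<close>.\<close>

lemma codazzi_normal:
  assumes z: "z \<in> R" and d\<kappa>: "(\<kappa> has_derivative d\<kappa>) (at z)"
  shows "c z = - ((\<kappa> z)\<^sup>2 * q z)"
    and "d\<kappa> (F z) = - (m * (\<kappa> z)\<^sup>2 * (1 + (\<kappa> z)\<^sup>2))"
proof -
  note s = s_pos[OF z]
  define D where "D u = DF z u" for u
  have F': "(F has_derivative D) (at z)" and E': "(E has_derivative (\<lambda>u. \<i> *s D u)) (at z)"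
    using F_derivative[of z] E_derivative[of z] by (simp_all add: D_def[abs_def])
  obtain dq where dq: "(q has_derivative dq) (at z)"
    using invariants_differentiable(2)[OF z] by (auto simp: differentiable_def)
  have "(\<lambda>z. (A z (F z) \<bullet> F z / s z - \<kappa> z) / s z) differentiable (at z)"
    using s invariants_differentiable[OF z] A_differentiable[OF z F_E_s_differentiable(1)] F_E_s_differentiable
    by (intro differentiable_divide differentiable_diff differentiable_inner) auto
  then obtain dc where dc: "(c has_derivative dc) (at z)"
    by (auto simp: differentiable_def c_def[abs_def])
  have qs: "q z * s z = m * \<kappa> z" using s by (simp add: q_def)
  have T: "T z u v w = d\<kappa> u * (v \<bullet> w) - (dq u * ((E z \<bullet> v) * (E z \<bullet> w))
      + q z * (((\<i> *s D u) \<bullet> v) * (E z \<bullet> w) + (E z \<bullet> v) * ((\<i> *s D u) \<bullet> w)))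
      + (\<kappa> z * q z * ((D u \<bullet> v) * (E z \<bullet> w) + (F z \<bullet> v) * ((\<i> *s D u) \<bullet> w)
           + ((\<i> *s D u) \<bullet> v) * (F z \<bullet> w) + (E z \<bullet> v) * (D u \<bullet> w))
        + (d\<kappa> u * q z + \<kappa> z * dq u) * ((F z \<bullet> v) * (E z \<bullet> w) + (E z \<bullet> v) * (F z \<bullet> w)))
      + (dc u * ((F z \<bullet> v) * (F z \<bullet> w)) + c z * ((D u \<bullet> v) * (F z \<bullet> w) + (F z \<bullet> v) * (D u \<bullet> w)))"
    for u v w
    by (rule T_unique[OF z hessian_decomposition_explicit, of _ _ "\<lambda>u. d\<kappa> u * (v \<bullet> w) - (dq u * ((E z \<bullet> v) * (E z \<bullet> w))
      + q z * (((\<i> *s D u) \<bullet> v) * (E z \<bullet> w) + (E z \<bullet> v) * ((\<i> *s D u) \<bullet> w)))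
      + (\<kappa> z * q z * ((D u \<bullet> v) * (E z \<bullet> w) + (F z \<bullet> v) * ((\<i> *s D u) \<bullet> w)
           + ((\<i> *s D u) \<bullet> v) * (F z \<bullet> w) + (E z \<bullet> v) * (D u \<bullet> w))
        + (d\<kappa> u * q z + \<kappa> z * dq u) * ((F z \<bullet> v) * (E z \<bullet> w) + (E z \<bullet> v) * (F z \<bullet> w)))
      + (dc u * ((F z \<bullet> v) * (F z \<bullet> w)) + c z * ((D u \<bullet> v) * (F z \<bullet> w) + (F z \<bullet> v) * (D u \<bullet> w)))"])
      (rule derivative_eq_intros d\<kappa> dq dc F' E' refl | simp add: fun_eq_iff algebra_simps)+
  note T = T[unfolded inner_i_left]
  obtain x where x: "x \<in> xi z" and "x \<noteq> 0"
    using nontrivial[of z] z by (auto simp: R_def xi_def E_def F_def)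
  define N where "N = x \<bullet> x"
  have N: "N > 0" using \<open>x \<noteq> 0\<close> by (simp add: N_def)
  note xs = xi_closed[OF x] xi_closed[OF xi_closed(5)[OF x]]
  have DX: "D x \<bullet> x = \<kappa> z * N" "D x \<bullet> (\<i> *s x) = N"
    "D (\<i> *s x) \<bullet> x = - N" "D (\<i> *s x) \<bullet> (\<i> *s x) = \<kappa> z * N"
    using xs by (simp_all add: D_def inner_add_left inner_diff_left hessian_decomposition_explicit[OF z] inner_i_left[of x] N_def)
  note S = T DX xs inner_i_left[of x x] N_def[symmetric]
  have 1: "T z x (\<i> *s x) (F z) = \<kappa> z * (q z * s z) * (\<kappa> z * N) + c z * s z * N"
    by (simp add: S)
  have 2: "T z (\<i> *s x) x (F z) = - (\<kappa> z * (q z * s z) * (\<kappa> z * N)) - c z * s z * N"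
    by (simp add: S)
  have "(N * s z) * (c z + (\<kappa> z)\<^sup>2 * q z) = 0"
    using 1 2 T_symmetric(2)[OF z, of x "\<i> *s x" "F z"] by algebra
  then show c: "c z = - ((\<kappa> z)\<^sup>2 * q z)"
    using N s by simp
  have 3: "T z x x (F z) = - (\<kappa> z * (q z * s z) * N) + c z * s z * (\<kappa> z * N)"
    by (simp add: S)
  have 4: "T z (F z) x x = d\<kappa> (F z) * N"
    by (simp add: S)
  have "T z x x (F z) = T z (F z) x x"
    using T_symmetric[OF z] by metis
  then have "N * (d\<kappa> (F z) + (m * (\<kappa> z)\<^sup>2 * (1 + (\<kappa> z)\<^sup>2))) = 0"
    using 3 4 c qs by algebra
  then show "d\<kappa> (F z) = - (m * (\<kappa> z)\<^sup>2 * (1 + (\<kappa> z)\<^sup>2))"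
    using N by (simp add: add_eq_0_iff2)
qed

text \<open>The coefficients found so far combine to a multiple of the identity plus a tensor of rank one in
  the direction \<open>V = E - \<kappa> F = (\<i> - \<kappa>) F\<close>, to which the differential of \<open>\<kappa>\<close> is proportional.\<close>

theorem structure_equations:
  assumes z: "z \<in> R"
  shows "(F has_derivative (\<lambda>u. \<kappa> z *\<^sub>R u + \<i> *s u - (m * \<kappa> z / s z * (V z \<bullet> u)) *\<^sub>R V z)) (at z)"
    and "(\<kappa> has_derivative (\<lambda>u. m * \<kappa> z * (1 + (\<kappa> z)\<^sup>2) / s z * (V z \<bullet> u))) (at z)"
proof -
  note s = s_pos[OF z]
  obtain d\<kappa> where d\<kappa>: "(\<kappa> has_derivative d\<kappa>) (at z)"
    using invariants_differentiable(1)[OF z] by (auto simp: differentiable_def)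
  note st = codazzi_tangential[OF z d\<kappa>] codazzi_normal[OF z d\<kappa>]
  have "A z u = \<kappa> z *\<^sub>R u - (m * \<kappa> z / s z * (V z \<bullet> u)) *\<^sub>R V z" for u
  proof (rule vector_eq_rdot[THEN iffD1], rule allI)
    fix w show "A z u \<bullet> w = (\<kappa> z *\<^sub>R u - (m * \<kappa> z / s z * (V z \<bullet> u)) *\<^sub>R V z) \<bullet> w"
      unfolding hessian_decomposition_explicit[OF z] st(4)
      by (simp add: V_def q_def inner_diff_left power2_eq_square algebra_simps add_divide_distrib diff_divide_distrib)
  qed
  then have "DF z = (\<lambda>u. \<kappa> z *\<^sub>R u + \<i> *s u - (m * \<kappa> z / s z * (V z \<bullet> u)) *\<^sub>R V z)"
    by (simp add: fun_eq_iff)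
  then show "(F has_derivative (\<lambda>u. \<kappa> z *\<^sub>R u + \<i> *s u - (m * \<kappa> z / s z * (V z \<bullet> u)) *\<^sub>R V z)) (at z)"
    using F_derivative[of z] by simp
  interpret bounded_linear d\<kappa>
    using d\<kappa> by (rule has_derivative_bounded_linear)
  have "d\<kappa> w = m * \<kappa> z * (1 + (\<kappa> z)\<^sup>2) / s z * (V z \<bullet> w)" for w
  proof -
    obtain x where x: "x \<in> xi z" and w: "w = (F z \<bullet> w / s z) *\<^sub>R F z + (E z \<bullet> w / s z) *\<^sub>R E z + x"
      using xi_decomposition[OF z] .
    have "d\<kappa> ((F z \<bullet> w / s z) *\<^sub>R F z + (E z \<bullet> w / s z) *\<^sub>R E z + x)
      = F z \<bullet> w / s z * d\<kappa> (F z) + E z \<bullet> w / s z * d\<kappa> (E z) + d\<kappa> x"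
      by (simp add: add scaleR)
    also have "\<dots> = m * \<kappa> z * (1 + (\<kappa> z)\<^sup>2) / s z * (V z \<bullet> w)"
      unfolding st(2) st(5) V_def inner_diff_left inner_scaleR_left
      using s st(3)[OF x] by (simp add: power2_eq_square field_simps)
    finally have "d\<kappa> ((F z \<bullet> w / s z) *\<^sub>R F z + (E z \<bullet> w / s z) *\<^sub>R E z + x)
      = m * \<kappa> z * (1 + (\<kappa> z)\<^sup>2) / s z * (V z \<bullet> w)" .
    then show ?thesis using w by simp
  qed
  then have "d\<kappa> = (\<lambda>u. m * \<kappa> z * (1 + (\<kappa> z)\<^sup>2) / s z * (V z \<bullet> u))"
    by (rule ext)
  then show "(\<kappa> has_derivative (\<lambda>u. m * \<kappa> z * (1 + (\<kappa> z)\<^sup>2) / s z * (V z \<bullet> u))) (at z)"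
    using d\<kappa> by simp
qed

text \<open>As \<open>V = (\<i> - \<kappa>) F\<close>, this is \<open>z - F / (\<kappa> + \<i>)\<close>. It turns out to be the centre of a rotational
  symmetry of \<open>\<kappa>\<close>.\<close>

definition P where "P z = z + (1 / (1 + (\<kappa> z)\<^sup>2)) *\<^sub>R V z"

text \<open>From the structure equations \<open>DV(u) = (2 m \<kappa>\<^sup>2 / |F|\<^sup>2) \<langle>V, u\<rangle> V - (1 + \<kappa>\<^sup>2) u\<close>. After division
  by \<open>1 + \<kappa>\<^sup>2\<close> the last term cancels the derivative of \<open>z\<close>, and the first one cancels the
  derivative of the factor \<open>1 / (1 + \<kappa>\<^sup>2)\<close>.\<close>

lemma P_derivative:
  assumes z: "z \<in> R"
  shows "(P has_derivative (\<lambda>u. 0)) (at z)"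
proof -
  note s = s_pos[OF z]
  note dF = structure_equations(1)[OF z] and d\<kappa> = structure_equations(2)[OF z]
  define t where "t u = V z \<bullet> u / s z" for u
  define k where "k = \<kappa> z"
  have dF': "(F has_derivative (\<lambda>u. k *\<^sub>R u + \<i> *s u - (m * k * t u) *\<^sub>R V z)) (at z)"
    using dF by (simp add: k_def t_def)
  have d\<kappa>': "(\<kappa> has_derivative (\<lambda>u. m * k * (1 + k\<^sup>2) * t u)) (at z)"
    using d\<kappa> by (simp add: k_def t_def)
  have VE: "V z = E z - k *\<^sub>R F z" by (simp add: V_def k_def)
  have dV: "(V has_derivative (\<lambda>u. (2 * m * k\<^sup>2 * t u) *\<^sub>R V z - (1 + k\<^sup>2) *\<^sub>R u)) (at z)"
  proof -
    have "((\<lambda>z. \<i> *s F z - \<kappa> z *\<^sub>R F z) has_derivative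
      (\<lambda>u. \<i> *s (k *\<^sub>R u + \<i> *s u - (m * k * t u) *\<^sub>R V z)
         - (\<kappa> z *\<^sub>R (k *\<^sub>R u + \<i> *s u - (m * k * t u) *\<^sub>R V z) + (m * k * (1 + k\<^sup>2) * t u) *\<^sub>R F z))) (at z)"
      by (intro has_derivative_diff has_derivative_i has_derivative_scaleR dF' d\<kappa>')
    moreover have "\<i> *s (k *\<^sub>R u + \<i> *s u - (m * k * t u) *\<^sub>R V z)
         - (\<kappa> z *\<^sub>R (k *\<^sub>R u + \<i> *s u - (m * k * t u) *\<^sub>R V z) + (m * k * (1 + k\<^sup>2) * t u) *\<^sub>R F z)
       = (2 * m * k\<^sup>2 * t u) *\<^sub>R V z - (1 + k\<^sup>2) *\<^sub>R u" for u
      unfolding k_def[symmetric] VE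
      by (rule vector_eq_rdot[THEN iffD1], rule allI)
        (simp only: i_linear i_i E_simps inner_diff_left inner_add_left inner_minus_left inner_scaleR_left, algebra)
    ultimately show ?thesis by (simp add: V_def[abs_def])
  qed
  have "((\<lambda>z. z + (1 / (1 + (\<kappa> z)\<^sup>2)) *\<^sub>R V z) has_derivative
    (\<lambda>u. u + ((1 / (1 + k\<^sup>2)) *\<^sub>R ((2 * m * k\<^sup>2 * t u) *\<^sub>R V z - (1 + k\<^sup>2) *\<^sub>R u)
       + (- (2 * k * (m * k * (1 + k\<^sup>2) * t u)) / (1 + k\<^sup>2)\<^sup>2) *\<^sub>R V z))) (at z)"
  proof (intro has_derivative_add has_derivative_ident)
    have "((\<lambda>z. 1 / (1 + (\<kappa> z)\<^sup>2)) has_derivative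
        (\<lambda>u. - (2 * k * (m * k * (1 + k\<^sup>2) * t u)) / (1 + k\<^sup>2)\<^sup>2)) (at z)"
      by (rule derivative_eq_intros d\<kappa>' refl one_plus_square | simp add: k_def power2_eq_square field_simps)+
    from has_derivative_scaleR[OF this dV]
    show "((\<lambda>z. (1 / (1 + (\<kappa> z)\<^sup>2)) *\<^sub>R V z) has_derivative
       (\<lambda>u. (1 / (1 + k\<^sup>2)) *\<^sub>R ((2 * m * k\<^sup>2 * t u) *\<^sub>R V z - (1 + k\<^sup>2) *\<^sub>R u)
       + (- (2 * k * (m * k * (1 + k\<^sup>2) * t u)) / (1 + k\<^sup>2)\<^sup>2) *\<^sub>R V z)) (at z)"
      by (simp add: k_def)
  qed
  moreover have "u + ((1 / (1 + k\<^sup>2)) *\<^sub>R ((2 * m * k\<^sup>2 * t u) *\<^sub>R V z - (1 + k\<^sup>2) *\<^sub>R u)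
       + (- (2 * k * (m * k * (1 + k\<^sup>2) * t u)) / (1 + k\<^sup>2)\<^sup>2) *\<^sub>R V z) = 0" for u
  proof -
    have "- (2 * k * (m * k * (1 + k\<^sup>2) * t u)) / (1 + k\<^sup>2)\<^sup>2 = - (2 * m * k\<^sup>2 * t u / (1 + k\<^sup>2))"
      using one_plus_square(2)[of k] by (simp add: power2_eq_square)
    then show ?thesis
      using one_plus_square(2)[of k] by (simp add: scaleR_diff_right)
  qed
  ultimately show ?thesis by (simp add: P_def[abs_def])
qed

section \<open>The centre of symmetry\<close>

text \<open>In particular \<open>|F| \<ge> |z - P z|\<close>. This keeps \<open>F\<close> away from zero where \<open>P\<close> has a given value.\<close>

lemma distance_P:
  assumes "z \<in> R"
  shows "s z = (1 + (\<kappa> z)\<^sup>2) * (norm (z - P z))\<^sup>2"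
proof -
  have "V z \<bullet> V z = (1 + (\<kappa> z)\<^sup>2) * s z"
    by (simp add: V_def inner_diff_left inner_diff_right power2_eq_square algebra_simps)
  moreover have P: "z - P z = - ((1 / (1 + (\<kappa> z)\<^sup>2)) *\<^sub>R V z)"
    by (simp add: P_def)
  ultimately show ?thesis
    unfolding power2_norm_eq_inner P using one_plus_square(2)[of "\<kappa> z"] by simp
qed

lemma open_P_preimage: "open {z \<in> R. P z \<in> S}"
proof (rule openI)
  fix z assume z: "z \<in> {z \<in> R. P z \<in> S}"
  then obtain e where e: "e > 0" "ball z e \<subseteq> R"
    using open_R openE by blast
  have "\<exists>c. \<forall>x\<in>ball z e. P x = c"
    by (rule has_derivative_zero_constant[OF convex_ball], rule has_derivative_at_withinI, rule P_derivative)
      (use e in auto)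
  then have "P x = P z" if "x \<in> ball z e" for x
    using that centre_in_ball[of z e] e by metis
  note const = this
  have "ball z e \<subseteq> {z \<in> R. P z \<in> S}"
  proof
    fix x assume x: "x \<in> ball z e"
    then show "x \<in> {z \<in> R. P z \<in> S}"
      using const[OF x] e(2) z by auto
  qed
  then show "\<exists>e>0. ball z e \<subseteq> {z \<in> R. P z \<in> S}"
    using e by blast
qed

lemma regular_set_punctured: "\<exists>p. R = - {p} \<and> (\<forall>z. z \<noteq> p \<longrightarrow> P z = p)"
proof -
  obtain z1 where z1: "z1 \<in> R"
    using graph_has_regular_point[OF C2] by (auto simp: R_def F_def)
  define p where "p = P z1"
  \<comment> \<open>\<open>U\<close> and \<open>W\<close> are open and disjoint. They cover the complement of \<open>p\<close>, because at a singular
     point other than \<open>p\<close> one has \<open>|F| = 0 < |z - p|\<close>.\<close>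
  define U where "U = {z \<in> R. P z \<in> {p}}"
  define W where "W = {z \<in> R. P z \<in> - {p}} \<union> {z. norm (F z) < norm (z - p)}"
  have "continuous_on UNIV F"
    using F_derivative has_derivative_continuous by (blast intro: continuous_at_imp_continuous_on)
  then have "open W"
    unfolding W_def by (intro open_Un open_P_preimage open_Collect_less continuous_intros)
  have le: "norm (z - P z) \<le> norm (F z)" if "z \<in> R" for z
  proof (rule power2_le_imp_le)
    have "(norm (F z))\<^sup>2 = (norm (z - P z))\<^sup>2 + (\<kappa> z)\<^sup>2 * (norm (z - P z))\<^sup>2"
      using distance_P[OF that] by (simp add: power2_norm_eq_inner algebra_simps)
    then show "(norm (z - P z))\<^sup>2 \<le> (norm (F z))\<^sup>2" by simp
  qed simp
  have disj: "U \<inter> W \<inter> - {p} = {}"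
    using le by (force simp: U_def W_def)
  have cover: "- {p} \<subseteq> U \<union> W"
    by (auto simp: U_def W_def R_def)
  have p: "p \<notin> U"
  proof
    assume "p \<in> U"
    then have "p \<in> R" "P p = p" by (auto simp: U_def)
    then show False using distance_P[of p] s_pos[of p] by simp
  qed
  have "z1 \<in> U \<inter> - {p}"
    using z1 p by (auto simp: U_def p_def)
  moreover have "connected (- {p})"
    by (rule connected_punctured_universe) simp
  moreover have "open U" unfolding U_def by (rule open_P_preimage)
  ultimately have "W \<inter> - {p} = {}"
    using connectedD[OF _ _ \<open>open W\<close> disj cover] by blast
  then have "- {p} \<subseteq> U" using cover by blast
  moreover have "p \<notin> R"
  proof
    assume "p \<in> R"
    then have "{z \<in> R. P z \<in> - {p}} = {p}"
      using p \<open>- {p} \<subseteq> U\<close> by (auto simp: U_def)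
    then show False
      using open_P_preimage[of "- {p}"] not_open_singleton[of p] by simp
  qed
  ultimately show ?thesis
    by (auto simp: U_def)
qed

text \<open>On the complement of \<open>p\<close> the equation for \<open>\<kappa>\<close> reads
  \<open>d\<kappa>(u) = - m \<kappa> (1 + \<kappa>\<^sup>2) \<langle>z - p, u\<rangle> / |z - p|\<^sup>2\<close>. Its first integral is \<open>Q\<close> below.\<close>

lemma graph_is_affine: "\<exists>p c. \<forall>z. f z = c - (\<i> *s p) \<bullet> z"
proof -
  obtain p where R: "R = - {p}" and P: "\<And>z. z \<noteq> p \<Longrightarrow> P z = p"
    using regular_set_punctured by blast
  have conn: "connected (- {p})"
    by (rule connected_punctured_universe) simp
  have V: "V z = (1 + (\<kappa> z)\<^sup>2) *\<^sub>R (p - z)" if "z \<noteq> p" for z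
  proof -
    have "p - z = (1 / (1 + (\<kappa> z)\<^sup>2)) *\<^sub>R V z"
      using P[OF that] by (simp add: P_def algebra_simps)
    then show ?thesis using one_plus_square(2)[of "\<kappa> z"] by simp
  qed
  have s: "s z = (1 + (\<kappa> z)\<^sup>2) * (norm (z - p))\<^sup>2" if "z \<noteq> p" for z
    using distance_P[of z] P[OF that] that R by simp
  have d\<kappa>: "(\<kappa> has_derivative (\<lambda>u. - (real M * \<kappa> z * (1 + (\<kappa> z)\<^sup>2) * ((z - p) \<bullet> u) / (norm (z - p))\<^sup>2))) (at z)"
    if "z \<noteq> p" for z
  proof -
    have "real M * \<kappa> z * (1 + (\<kappa> z)\<^sup>2) / s z * (V z \<bullet> u)
       = - (real M * \<kappa> z * (1 + (\<kappa> z)\<^sup>2) * ((z - p) \<bullet> u) / (norm (z - p))\<^sup>2)" for u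
      unfolding s[OF that] V[OF that] inner_scaleR_left
      using one_plus_square(2)[of "\<kappa> z"] that by (simp add: inner_diff_left right_diff_distrib diff_divide_distrib)
    then show ?thesis using structure_equations(2)[of z] that R by simp
  qed
  define Q where "Q z = ((norm (z - p))\<^sup>2) ^ M * ((\<kappa> z)\<^sup>2 / (1 + (\<kappa> z)\<^sup>2))" for z
  have dQ: "(Q has_derivative (\<lambda>u. 0)) (at z)" if "z \<noteq> p" for z
  proof -
    define r where "r = (norm (z - p))\<^sup>2"
    define k where "k = \<kappa> z"
    define t where "t u = (z - p) \<bullet> u" for u
    have r: "r \<noteq> 0" using that by (simp add: r_def)
    have dk: "(\<kappa> has_derivative (\<lambda>u. - (real M * k * (1 + k\<^sup>2) * t u / r))) (at z)"
      using d\<kappa>[OF that] by (simp add: k_def r_def t_def)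
    have "((\<lambda>x. x\<^sup>2 / (1 + x\<^sup>2)) has_real_derivative 2 * k / ((1 + k\<^sup>2) * (1 + k\<^sup>2))) (at (\<kappa> z))"
    proof -
      have "2 * k * (1 + k\<^sup>2) - k\<^sup>2 * (2 * k) = 2 * k" by algebra
      then show ?thesis
        by (auto intro!: derivative_eq_intros one_plus_square simp: k_def simp del: one_plus_square(2))
    qed
    from DERIV_compose_FDERIV[OF this dk]
    have "((\<lambda>z. (\<kappa> z)\<^sup>2 / (1 + (\<kappa> z)\<^sup>2)) has_derivative (\<lambda>u. - (2 * real M * t u / r * (k\<^sup>2 / (1 + k\<^sup>2))))) (at z)"
    proof (rule has_derivative_eq_rhs)
      have "- (real M * k * g * x / r) * (2 * k / (g * g)) = - (2 * real M * x / r * (k\<^sup>2 / g))"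
        if "g \<noteq> 0" for g x
        using that by (simp add: power2_eq_square)
      from this[OF one_plus_square(2)]
      show "(\<lambda>u. - (real M * k * (1 + k\<^sup>2) * t u / r) * (2 * k / ((1 + k\<^sup>2) * (1 + k\<^sup>2))))
          = (\<lambda>u. - (2 * real M * t u / r * (k\<^sup>2 / (1 + k\<^sup>2))))"
        by (rule ext)
    qed
    moreover have "((\<lambda>z. ((z - p) \<bullet> (z - p)) ^ M) has_derivative (\<lambda>u. of_nat M * (2 * t u) * r ^ (M - 1))) (at z)"
      by (rule derivative_eq_intros refl)+
        (simp add: t_def r_def power2_norm_eq_inner inner_commute fun_eq_iff)
    ultimately have "((\<lambda>z. ((z - p) \<bullet> (z - p)) ^ M * ((\<kappa> z)\<^sup>2 / (1 + (\<kappa> z)\<^sup>2))) has_derivative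
       (\<lambda>u. ((z - p) \<bullet> (z - p)) ^ M * (- (2 * real M * t u / r * (k\<^sup>2 / (1 + k\<^sup>2))))
           + of_nat M * (2 * t u) * r ^ (M - 1) * ((\<kappa> z)\<^sup>2 / (1 + (\<kappa> z)\<^sup>2)))) (at z)"
      by (intro has_derivative_mult)
    moreover have "((z - p) \<bullet> (z - p)) ^ M * (- (2 * real M * t u / r * (k\<^sup>2 / (1 + k\<^sup>2))))
           + of_nat M * (2 * t u) * r ^ (M - 1) * ((\<kappa> z)\<^sup>2 / (1 + (\<kappa> z)\<^sup>2)) = 0" for u
    proof -
      have "((z - p) \<bullet> (z - p)) ^ M = r * r ^ (M - 1)"
        using M by (simp add: r_def power2_norm_eq_inner flip: power_Suc)
      then show ?thesis using r by (simp add: k_def)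
    qed
    ultimately show ?thesis
      by (simp add: Q_def[abs_def] power2_norm_eq_inner)
  qed
  have \<kappa>0: "\<kappa> z = 0" if z: "z \<noteq> p" for z
  proof -
    have const: "Q x = Q z" if "x \<noteq> p" for x
      using has_derivative_zero_unique_connected[of "- {p}" Q x z] conn dQ that z
      by (auto simp: open_delete)
    \<comment> \<open>The constant \<open>Q\<close> is evaluated at distance \<open>t\<close> from \<open>p\<close>, where the factor
       \<open>\<kappa>\<^sup>2 / (1 + \<kappa>\<^sup>2)\<close> is at most 1.\<close>
    have small: "Q z \<le> t" if "0 < t" "t < 1" for t
    proof -
      define x where "x = p + t *\<^sub>R axis undefined 1"
      have n: "norm (x - p) = t"
        using that by (simp add: x_def)
      have "Q z = Q x"
        using const[of x] n that by auto
      also have "\<dots> = (t\<^sup>2) ^ M * ((\<kappa> x)\<^sup>2 / (1 + (\<kappa> x)\<^sup>2))"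
        by (simp add: Q_def n)
      also have "\<dots> \<le> (t\<^sup>2) ^ M * 1"
        using one_plus_square(1)[of "\<kappa> x"] by (intro mult_left_mono) auto
      also have "\<dots> = t ^ (2 * M)" by (simp add: power_mult)
      also have "\<dots> \<le> t ^ 1"
        using that M by (intro power_decreasing) auto
      finally show ?thesis by simp
    qed
    have "Q z \<le> 0"
    proof (rule ccontr)
      assume *: "\<not> Q z \<le> 0"
      define t where "t = min (Q z / 2) (1 / 2)"
      have "0 < t" "t < 1" "t < Q z" using * by (auto simp: t_def min_less_iff_disj)
      then show False using small[of t] by simp
    qed
    moreover have "Q z \<ge> 0"
      unfolding Q_def by (intro mult_nonneg_nonneg) (auto intro: add_nonneg_nonneg)
    ultimately have "Q z = 0" by simp
    then show ?thesis
      using z one_plus_square(2)[of "\<kappa> z"] by (simp add: Q_def)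
  qed
  have grad: "gradient f z = - (\<i> *s p)" if "z \<noteq> p" for z
  proof -
    have "E z = p - z"
      using V[OF that] \<kappa>0[OF that] by (simp add: V_def)
    then have "\<i> *s E z = \<i> *s (p - z)" by simp
    then have "F z = \<i> *s z - \<i> *s p"
      by (simp add: i_linear) (metis minus_diff_eq minus_equation_iff)
    then show ?thesis
      by (simp add: F_def horizontal_gradient_def eq_neg_iff_add_eq_0 algebra_simps)
  qed
  have df: "(f has_derivative (\<lambda>h. gradient f z \<bullet> h)) (at z)" for z
    using has_derivative_gradient C_k_on_2_differentiable(1)[OF C2] by blast
  define g where "g z = f z + (\<i> *s p) \<bullet> z" for z
  have dg: "(g has_derivative (\<lambda>h. gradient f z \<bullet> h + (\<i> *s p) \<bullet> h)) (at z)" for z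
    unfolding g_def by (intro derivative_intros df)
  \<comment> \<open>The gradient is known off \<open>p\<close> only; one exceptional point is harmless for the continuous \<open>g\<close>.\<close>
  have "g z = g 0" for z
  proof (rule has_derivative_zero_unique_strong_connected[of UNIV "{p}" g 0 "g 0"])
    show "continuous_on UNIV g"
      using dg has_derivative_continuous by (blast intro: continuous_at_imp_continuous_on)
    show "(g has_derivative (\<lambda>h. 0)) (at x within UNIV)" if "x \<in> UNIV - {p}" for x
      using dg[of x] grad[of x] that by simp
  qed auto
  then have "f z = g 0 - (\<i> *s p) \<bullet> z" for z
    by (metis g_def add_diff_cancel_right')
  then show ?thesis by blast
qed

end

section \<open>Graphs that are umbilic and p-minimal\<close>

theorem corollary4p6:
  fixes f :: "complex ^ 'n::finite \<Rightarrow> real" and \<Sigma> :: "'n heis set"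
  assumes "graph_hypersurface f"
    and "\<Sigma> = heis_graph f"
    and "p_minimal \<Sigma>"
    and "umbilic \<Sigma>"
  shows "\<exists>\<phi>\<in>PSH. \<exists>c::real. \<phi> ` \<Sigma> = {(z, t). t = c}"
proof -
  have C2: "C_k_on 2 f UNIV" and "smooth_on f {z. regular_point (heis_graph f) (z, f z)}"
    using assms(1) by (auto simp: graph_hypersurface_def)
  then have C3: "C_k_on 3 f {z. horizontal_gradient f z \<noteq> 0}"
    by (simp add: smooth_on_def regular_point_graph[OF C2])
  have fields: "\<exists>U e U' e'. characteristic_field (heis_graph f) U e \<and> (z, f z) \<in> U \<and>
      umbilic_point (heis_graph f) e (z, f z) \<and>
      characteristic_field (heis_graph f) U' e' \<and> (z, f z) \<in> U' \<and>
      p_mean_curvature (heis_graph f) e' (z, f z) = 0"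
    if "horizontal_gradient f z \<noteq> 0" for z
  proof -
    have "regular_point \<Sigma> (z, f z)"
      using that by (simp add: assms(2) regular_point_graph[OF C2])
    with assms(3,4) show ?thesis
      unfolding p_minimal_def umbilic_def assms(2) by blast
  qed
  interpret umbilic_minimal_graph f "2 * CARD('n) - 1"
  proof
    show "C_k_on 2 f UNIV" "C_k_on 3 f {z. horizontal_gradient f z \<noteq> 0}"
      by (fact C2 C3)+
    obtain z where z: "horizontal_gradient f z \<noteq> 0"
      using graph_has_regular_point[OF C2] .
    show "1 < 2 * CARD('n) - 1"
      using fields[OF z] umbilic_minimal_hessian(1)[OF C2 z] by blast
  next
    fix z assume z: "horizontal_gradient f z \<noteq> 0"
    show "\<exists>x. x \<noteq> 0 \<and> horizontal_gradient f z \<bullet> x = 0 \<and> (\<i> *s horizontal_gradient f z) \<bullet> x = 0"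
      using fields[OF z] umbilic_point_hessian(1)[OF C2 z] by blast
    show "\<exists>k. \<forall>v w. horizontal_gradient f z \<bullet> v = 0 \<longrightarrow> horizontal_gradient f z \<bullet> w = 0 \<longrightarrow>
        hessian f z v \<bullet> w = k * (v \<bullet> w) - real (2 * CARD('n) - 1) * k / (norm (horizontal_gradient f z))\<^sup>2 *
          (((\<i> *s horizontal_gradient f z) \<bullet> v) * ((\<i> *s horizontal_gradient f z) \<bullet> w))"
      using fields[OF z] umbilic_minimal_hessian(2)[OF C2 z] by blast
  qed
  obtain p c where f: "\<And>z. f z = c - (\<i> *s p) \<bullet> z"
    using graph_is_affine by blast
  have shift: "heis_mult (- p, 0) (z, t) = (z - p, t + (\<i> *s p) \<bullet> z)" for z t
  proof -
    have "(\<Sum>j\<in>UNIV. Re (p $ j) * Im (z $ j) - Im (p $ j) * Re (z $ j)) = (\<i> *s p) \<bullet> z"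
      unfolding inner_vec_def inner_complex_def by (rule sum.cong) simp_all
    then show ?thesis by (simp add: heis_mult_def)
  qed
  have "heis_mult (- p, 0) ` \<Sigma> = {(z, t). t = c}"
  proof
    show "heis_mult (- p, 0) ` \<Sigma> \<subseteq> {(z, t). t = c}"
      by (auto simp: assms(2) heis_graph_def shift f)
    show "{(z, t). t = c} \<subseteq> heis_mult (- p, 0) ` \<Sigma>"
    proof
      fix x :: "'n heis" assume "x \<in> {(z, t). t = c}"
      then have "x = heis_mult (- p, 0) (fst x + p, f (fst x + p))"
        by (auto simp: shift f)
      then show "x \<in> heis_mult (- p, 0) ` \<Sigma>"
        by (auto simp: assms(2) heis_graph_def)
    qed
  qed
  then show ?thesis
    using PSH.translation by blast
qed

end
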